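(* The second eigenvalue $\lambda_2$ of the problem $-\mathcal L_Ku=\lambda u$ in $\Omega$, $u=0$ in $\mathbb R^n\setminus\Omega$, has the variational characterization $$\lambda_2=\inf_{\gamma\in\Gamma}\ \max_{u\in\gamma([-1,1])}\int_Q(u(x)-u(y))^2K(x-y)\,dx\,dy,$$ where $\Gamma=\{\gamma\in C([-1,1],\mathcal P):\gamma(-1)=-\phi_1,\ \gamma(1)=\phi_1\}$.
   Context: Let $s\in(0,1)$, $n>2s$, and let $\Omega\subset\mathbb R^n$ be a bounded domain with Lipschitz boundary. Let $K:\mathbb R^n\setminus\{0\}\to(0,\infty)$ satisfy: (i) $mK\in L^1(\mathbb R^n)$ with $m(x)=\min\{|x|^2,1\}$; (ii) there is $\lambda>0$ with $K(x)\ge\lambda|x|^{-(n+2s)}$ for all $x\ne0$; (iii) $K(x)=K(-x)$. Put $Q=\mathbb R^{2n}\setminus((\mathbb R^n\setminus\Omega)\times(\mathbb R^n\setminus\Omega))$. Let $X$ be the space of measurable $u:\mathbb R^n\to\mathbb R$ with $u|_\Omega\in L^2(\Omega)$ and $(u(x)-u(y))\sqrt{K(x-y)}\in L^2(Q)$, and let $X_0=\{u\in X: u=0 \text{ a.e. in }\mathbb R^n\setminus\Omega\}$, a Hilbert space with norm $\|u\|_{X_0}=\left(\int_Q|u(x)-u(y)|^2K(x-y)\,dx\,dy\right)^{1/2}$. The operator is $\mathcal L_Ku(x)=\frac12\int_{\mathbb R^n}(u(x+y)+u(x-y)-2u(x))K(y)\,dy$. Eigenvalues are understood weakly: $\lambda$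 is an eigenvalue if there is a nonzero $u\in X_0$ with $\int_Q(u(x)-u(y))(v(x)-v(y))K(x-y)\,dx\,dy=\lambda\int_\Omega uv\,dx$ for all $v\in X_0$. $\lambda_1=\inf\{\|u\|_{X_0}^2: u\in X_0,\ \int_\Omega u^2=1\}$ is the first eigenvalue; it is simple and its eigenfunctions have constant sign; $\phi_1$ denotes the associated nonnegative eigenfunction with $\int_\Omega\phi_1^2=1$. The second eigenvalue $\lambda_2$ is the smallest eigenvalue larger than $\lambda_1$. Let $\mathcal P=\{u\in X_0:\int_\Omega u^2\,dx=1\}$ with the topology of $X_0$. *)

theory Defs
  imports "HOL-Analysis.Analysis"
begin

text \<open>Elements of the function spaces below are represented by functions, identified up to
  equality almost everywhere. All integrals are Lebesgue integrals.\<close>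

text \<open>Near each boundary point the domain is the strict epigraph, in some direction \<open>e\<close>, of a
  Lipschitz function on the hyperplane orthogonal to \<open>e\<close>; the vector \<open>x - (x \<bullet> e) *\<^sub>R e\<close> is the
  projection of \<open>x\<close> to that hyperplane.\<close>

definition lipschitz_boundary :: "(real ^ 'n) set \<Rightarrow> bool" where
  "lipschitz_boundary \<Omega> \<longleftrightarrow>
     (\<forall>p \<in> frontier \<Omega>. \<exists>r > 0. \<exists>e g C. norm e = 1 \<and>
        C-lipschitz_on {z. z \<bullet> e = 0} (g :: real ^ 'n \<Rightarrow> real) \<and>
        \<Omega> \<inter> ball p r = {x \<in> ball p r. x \<bullet> e > g (x - (x \<bullet> e) *\<^sub>R e)})"

definition bounded_lipschitz_domain :: "(real ^ 'n) set \<Rightarrow> bool" where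
  "bounded_lipschitz_domain \<Omega> \<longleftrightarrow>
     open \<Omega> \<and> connected \<Omega> \<and> \<Omega> \<noteq> {} \<and> bounded \<Omega> \<and> lipschitz_boundary \<Omega>"

text \<open>The kernel lives on the complement of the origin; the value \<open>K 0\<close> is irrelevant.\<close>

definition admissible_kernel :: "real \<Rightarrow> (real ^ 'n \<Rightarrow> real) \<Rightarrow> bool" where
  "admissible_kernel s K \<longleftrightarrow>
     (\<forall>x. x \<noteq> 0 \<longrightarrow> K x > 0) \<and>
     integrable lebesgue (\<lambda>x. min ((norm x)\<^sup>2) 1 * K x) \<and>
     (\<exists>c > 0. \<forall>x. x \<noteq> 0 \<longrightarrow> K x \<ge> c * norm x powr (- (real CARD('n) + 2 * s))) \<and>
     (\<forall>x. x \<noteq> 0 \<longrightarrow> K x = K (- x))"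

definition Q_set :: "(real ^ 'n) set \<Rightarrow> ((real ^ 'n) \<times> (real ^ 'n)) set" where
  "Q_set \<Omega> = UNIV - ((UNIV - \<Omega>) \<times> (UNIV - \<Omega>))"

definition L2_on :: "'a::euclidean_space set \<Rightarrow> ('a \<Rightarrow> real) \<Rightarrow> bool" where
  "L2_on A f \<longleftrightarrow>
     set_borel_measurable lebesgue A f \<and> set_integrable lebesgue A (\<lambda>x. (f x)\<^sup>2)"

definition X_space :: "(real ^ 'n \<Rightarrow> real) \<Rightarrow> (real ^ 'n) set \<Rightarrow> (real ^ 'n \<Rightarrow> real) set" where
  "X_space K \<Omega> =
     {u. u \<in> borel_measurable lebesgue \<and> L2_on \<Omega> u \<and>
         L2_on (Q_set \<Omega>) (\<lambda>(x, y). (u x - u y) * sqrt (K (x - y)))}"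

definition X0_space :: "(real ^ 'n \<Rightarrow> real) \<Rightarrow> (real ^ 'n) set \<Rightarrow> (real ^ 'n \<Rightarrow> real) set" where
  "X0_space K \<Omega> = {u \<in> X_space K \<Omega>. AE x in lebesgue. x \<notin> \<Omega> \<longrightarrow> u x = 0}"

definition energy :: "(real ^ 'n \<Rightarrow> real) \<Rightarrow> (real ^ 'n) set \<Rightarrow> (real ^ 'n \<Rightarrow> real) \<Rightarrow> real" where
  "energy K \<Omega> u = (LINT (x, y):Q_set \<Omega>|lebesgue. (u x - u y)\<^sup>2 * K (x - y))"

definition X0_norm :: "(real ^ 'n \<Rightarrow> real) \<Rightarrow> (real ^ 'n) set \<Rightarrow> (real ^ 'n \<Rightarrow> real) \<Rightarrow> real" where
  "X0_norm K \<Omega> u = sqrt (energy K \<Omega> u)"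

definition weak_solution ::
  "(real ^ 'n \<Rightarrow> real) \<Rightarrow> (real ^ 'n) set \<Rightarrow> real \<Rightarrow> (real ^ 'n \<Rightarrow> real) \<Rightarrow> bool" where
  "weak_solution K \<Omega> \<mu> u \<longleftrightarrow> u \<in> X0_space K \<Omega> \<and>
     (\<forall>v \<in> X0_space K \<Omega>.
        (LINT (x, y):Q_set \<Omega>|lebesgue. (u x - u y) * (v x - v y) * K (x - y))
          = \<mu> * (LINT x:\<Omega>|lebesgue. u x * v x))"

definition eigenfunction ::
  "(real ^ 'n \<Rightarrow> real) \<Rightarrow> (real ^ 'n) set \<Rightarrow> real \<Rightarrow> (real ^ 'n \<Rightarrow> real) \<Rightarrow> bool" where
  "eigenfunction K \<Omega> \<mu> u \<longleftrightarrow> weak_solution K \<Omega> \<mu> u \<and> \<not> (AE x in lebesgue. u x = 0)"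

definition eigenvalue :: "(real ^ 'n \<Rightarrow> real) \<Rightarrow> (real ^ 'n) set \<Rightarrow> real \<Rightarrow> bool" where
  "eigenvalue K \<Omega> \<mu> \<longleftrightarrow> (\<exists>u. eigenfunction K \<Omega> \<mu> u)"

definition P_sphere :: "(real ^ 'n \<Rightarrow> real) \<Rightarrow> (real ^ 'n) set \<Rightarrow> (real ^ 'n \<Rightarrow> real) set" where
  "P_sphere K \<Omega> = {u \<in> X0_space K \<Omega>. (LINT x:\<Omega>|lebesgue. (u x)\<^sup>2) = 1}"

definition first_eigenvalue :: "(real ^ 'n \<Rightarrow> real) \<Rightarrow> (real ^ 'n) set \<Rightarrow> real" where
  "first_eigenvalue K \<Omega> = (INF u \<in> P_sphere K \<Omega>. (X0_norm K \<Omega> u)\<^sup>2)"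

definition second_eigenvalue :: "(real ^ 'n \<Rightarrow> real) \<Rightarrow> (real ^ 'n) set \<Rightarrow> real" where
  "second_eigenvalue K \<Omega> = (LEAST \<mu>. eigenvalue K \<Omega> \<mu> \<and> first_eigenvalue K \<Omega> < \<mu>)"

definition normalized_first_eigenfunction ::
  "(real ^ 'n \<Rightarrow> real) \<Rightarrow> (real ^ 'n) set \<Rightarrow> (real ^ 'n \<Rightarrow> real) \<Rightarrow> bool" where
  "normalized_first_eigenfunction K \<Omega> \<phi> \<longleftrightarrow>
     eigenfunction K \<Omega> (first_eigenvalue K \<Omega>) \<phi> \<and>
     (AE x in lebesgue. \<phi> x \<ge> 0) \<and> (LINT x:\<Omega>|lebesgue. (\<phi> x)\<^sup>2) = 1"

text \<open>Continuous paths for the \<open>X\<^sub>0\<close>-norm; values outside \<open>{-1..1}\<close> are arbitrary.\<close>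

definition Gamma_paths ::
  "(real ^ 'n \<Rightarrow> real) \<Rightarrow> (real ^ 'n) set \<Rightarrow> (real ^ 'n \<Rightarrow> real)
     \<Rightarrow> (real \<Rightarrow> real ^ 'n \<Rightarrow> real) set" where
  "Gamma_paths K \<Omega> \<phi> =
     {\<gamma>. (\<forall>t \<in> {-1..1}. \<gamma> t \<in> P_sphere K \<Omega>) \<and>
         (\<forall>t \<in> {-1..1}.
            ((\<lambda>t'. X0_norm K \<Omega> (\<lambda>x. \<gamma> t' x - \<gamma> t x)) \<longlongrightarrow> 0) (at t within {-1..1})) \<and>
         (AE x in lebesgue. \<gamma> (-1) x = - \<phi> x) \<and>
         (AE x in lebesgue. \<gamma> 1 x = \<phi> x)}"

text \<open>The maximum of \<open>f\<close> over a possibly infinite set (\<open>Max\<close> is for finite sets only).\<close>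

definition maximum_on :: "'a set \<Rightarrow> ('a \<Rightarrow> real) \<Rightarrow> real" where
  "maximum_on A f = (GREATEST r. r \<in> f ` A)"

end

theory Submission
  imports Defs
begin

text \<open>
Let \<open>\<mu>\<^sub>2\<close> be the infimum of the energy over the functions of unit \<open>L\<^sup>2\<close> norm that are orthogonal to the
first eigenfunction \<open>\<phi>\<close>. The problem is linear, so \<open>\<mu>\<^sub>2\<close> links both sides of the claim.

A minimizer \<open>\<psi>\<close> for \<open>\<mu>\<^sub>2\<close> exists (\<open>minimizer_exists\<close>) and is an eigenfunction (\<open>minimizer_weak\<close>). Every
eigenfunction whose eigenvalue differs from the first one is orthogonal to \<open>\<phi>\<close>, so its
eigenvalue is at least \<open>\<mu>\<^sub>2\<close>. The first eigenvalue is strictly smaller than \<open>\<mu>\<^sub>2\<close>, because minimizers of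
the Rayleigh quotient have constant sign and two orthogonal ones cannot coexist
(\<open>minimizer_constant_sign\<close>, \<open>no_orthogonal_minimizer\<close>). Hence \<open>\<mu>\<^sub>2\<close> is the second eigenvalue.

For the minimax value, a path from \<open>- \<phi>\<close> to \<open>\<phi>\<close> must cross the orthogonal complement of \<open>\<phi>\<close>, and there
its energy is at least \<open>\<mu>\<^sub>2\<close>; the half circle from \<open>- \<phi>\<close> over \<open>\<psi>\<close> to \<open>\<phi>\<close> has maximal energy exactly \<open>\<mu>\<^sub>2\<close>.

The analytic input is the existence of \<open>\<psi>\<close>. Compactness enters through one inequality (\<open>spectral_gap\<close>):
partitioning into cubes of side \<open>h\<close> and using the lower bound of \<open>K\<close> on each cube,
\<open>E u \<ge> \<Lambda> \<integral> u\<^sup>2 - C \<Sum> (\<integral>\<^sub>A u)\<^sup>2\<close> with \<open>\<Lambda>\<close> proportional to \<open>h\<^sup>-\<^sup>2\<^sup>s\<close> and a finite sum over cubes \<open>A\<close>. The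
parallelogram law then makes a minimizing sequence Cauchy in \<open>L\<^sup>2\<close> along a subsequence, and Fatou's lemma
passes to the limit (\<open>form_closed\<close>). The same argument with one large cube is the Poincare inequality.
\<close>

section \<open>Pairs of positive semidefinite forms\<close>

locale psd_form =
  fixes V :: "('a \<Rightarrow> real) set" and B :: "('a \<Rightarrow> real) \<Rightarrow> ('a \<Rightarrow> real) \<Rightarrow> real"
  assumes V_lin: "u \<in> V \<Longrightarrow> v \<in> V \<Longrightarrow> (\<lambda>x. a * u x + b * v x) \<in> V"
    and B_lin: "u \<in> V \<Longrightarrow> v \<in> V \<Longrightarrow> w \<in> V \<Longrightarrow>
      B (\<lambda>x. a * u x + b * v x) w = a * B u w + b * B v w"
    and B_sym: "u \<in> V \<Longrightarrow> v \<in> V \<Longrightarrow> B u v = B v u"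
    and B_nonneg: "u \<in> V \<Longrightarrow> B u u \<ge> 0"
begin

lemma B_lin_right:
  assumes "u \<in> V" "v \<in> V" "w \<in> V"
  shows "B w (\<lambda>x. a * u x + b * v x) = a * B w u + b * B w v"
  using B_lin[OF assms, of a b] B_sym V_lin assms by (metis (no_types, lifting))

lemma B_quadratic:
  assumes "u \<in> V" "v \<in> V"
  shows "B (\<lambda>x. a * u x + b * v x) (\<lambda>x. a * u x + b * v x)
    = a\<^sup>2 * B u u + 2 * a * b * B u v + b\<^sup>2 * B v v"
  using assms by (simp add: B_lin B_lin_right V_lin B_sym[of v u] power2_eq_square algebra_simps)

lemma V_add: "u \<in> V \<Longrightarrow> v \<in> V \<Longrightarrow> (\<lambda>x. u x + v x) \<in> V"
  using V_lin[of u v 1 1] by simp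

lemma V_diff: "u \<in> V \<Longrightarrow> v \<in> V \<Longrightarrow> (\<lambda>x. u x - v x) \<in> V"
  using V_lin[of u v 1 "-1"] by simp

lemma V_scale: "u \<in> V \<Longrightarrow> (\<lambda>x. a * u x) \<in> V"
  using V_lin[of u u a 0] by simp

lemma B_add_quadratic:
  "u \<in> V \<Longrightarrow> v \<in> V \<Longrightarrow> B (\<lambda>x. u x + v x) (\<lambda>x. u x + v x) = B u u + 2 * B u v + B v v"
  using B_quadratic[of u v 1 1] by simp

lemma B_diff_quadratic:
  "u \<in> V \<Longrightarrow> v \<in> V \<Longrightarrow> B (\<lambda>x. u x - v x) (\<lambda>x. u x - v x) = B u u - 2 * B u v + B v v"
  using B_quadratic[of u v 1 "-1"] by simp

lemma B_scale_quadratic: "u \<in> V \<Longrightarrow> B (\<lambda>x. a * u x) (\<lambda>x. a * u x) = a\<^sup>2 * B u u"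
  using B_quadratic[of u u a 0] by simp

lemma B_diff_right:
  "u \<in> V \<Longrightarrow> v \<in> V \<Longrightarrow> w \<in> V \<Longrightarrow> B w (\<lambda>x. u x - v x) = B w u - B w v"
  using B_lin_right[of u v w 1 "-1"] by simp

lemma B_scale_right:
  "u \<in> V \<Longrightarrow> w \<in> V \<Longrightarrow> B w (\<lambda>x. a * u x) = a * B w u"
  using B_lin_right[of u u w a 0] by simp

lemma B_add_right:
  "u \<in> V \<Longrightarrow> v \<in> V \<Longrightarrow> w \<in> V \<Longrightarrow> B w (\<lambda>x. u x + v x) = B w u + B w v"
  using B_lin_right[of u v w 1 1] by simp

text \<open>Besides its usual role, this inequality yields the Euler--Lagrange equation: an isotropic vector
\<open>\<psi>\<close> of a positive semidefinite form is orthogonal to everything. Definiteness is not available,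
since functions that agree almost everywhere are not identified.\<close>

lemma cauchy_schwarz:
  assumes u: "u \<in> V" and v: "v \<in> V"
  shows "(B u v)\<^sup>2 \<le> B u u * B v v"
proof (cases "B v v = 0")
  case True
  have "B u v = 0"
  proof (rule ccontr)
    assume ne: "B u v \<noteq> 0"
    \<comment> \<open>As \<open>B v v = 0\<close>, the form is affine in \<open>b\<close> along \<open>u + b v\<close>; this \<open>b\<close> makes it equal to \<open>-1\<close>.\<close>
    define b where "b = - (B u u + 1) / (2 * B u v)"
    have "0 \<le> B u u + 2 * b * B u v"
      using B_nonneg[OF V_lin[OF u v, of 1 b]] B_quadratic[OF u v, of 1 b] True by simp
    moreover have "2 * b * B u v = - (B u u + 1)"
      using ne by (simp add: b_def)
    ultimately show False by simp
  qed
  then show ?thesis by (simp add: True)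
next
  case False
  then have pos: "B v v > 0" using B_nonneg[OF v] by simp
  have "0 \<le> (B v v)\<^sup>2 * B u u + 2 * B v v * (- B u v) * B u v + (- B u v)\<^sup>2 * B v v"
    using B_nonneg[OF V_lin[OF u v, of "B v v" "- B u v"]]
    by (simp only: B_quadratic[OF u v])
  also have "\<dots> = B v v * (B u u * B v v - (B u v)\<^sup>2)"
    by (simp add: power2_eq_square algebra_simps)
  finally show ?thesis
    using pos by (simp add: zero_le_mult_iff)
qed

text \<open>The triangle inequality, in the form that makes \<open>u \<mapsto> B u u\<close> continuous.\<close>

lemma sqrt_B_diff_le:
  assumes u: "u \<in> V" and v: "v \<in> V"
  shows "\<bar>sqrt (B u u) - sqrt (B v v)\<bar> \<le> sqrt (B (\<lambda>x. u x - v x) (\<lambda>x. u x - v x))"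
proof -
  have "B u v \<le> sqrt (B u u) * sqrt (B v v)"
    using real_le_rsqrt[OF cauchy_schwarz[OF u v]] by (simp add: real_sqrt_mult)
  then have "(sqrt (B u u) - sqrt (B v v))\<^sup>2 \<le> B (\<lambda>x. u x - v x) (\<lambda>x. u x - v x)"
    unfolding B_diff_quadratic[OF u v]
    using B_nonneg[OF u] B_nonneg[OF v] by (simp add: power2_diff)
  then have "sqrt ((sqrt (B u u) - sqrt (B v v))\<^sup>2)
      \<le> sqrt (B (\<lambda>x. u x - v x) (\<lambda>x. u x - v x))"
    by (rule real_sqrt_le_mono)
  then show ?thesis by simp
qed

end

lemma bounded_family_subsequence:
  fixes a :: "'i \<Rightarrow> nat \<Rightarrow> real"
  assumes "finite I" and "\<And>i. i \<in> I \<Longrightarrow> bounded (range (a i))"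
  shows "\<exists>r. strict_mono (r :: nat \<Rightarrow> nat) \<and> (\<forall>i\<in>I. convergent (\<lambda>n. a i (r n)))"
  using assms
proof (induction I rule: finite_induct)
  case empty
  show ?case by (auto intro: exI[of _ id] simp: strict_mono_def)
next
  case (insert i I)
  then obtain r where r: "strict_mono (r :: nat \<Rightarrow> nat)" "\<forall>i\<in>I. convergent (\<lambda>n. a i (r n))"
    by auto
  have "bounded (range (\<lambda>n. a i (r n)))"
    by (rule bounded_subset[OF insert.prems[of i]]) auto
  then obtain l q where q: "strict_mono (q :: nat \<Rightarrow> nat)" "((\<lambda>n. a i (r n)) \<circ> q) \<longlonglongrightarrow> l"
    using bounded_imp_convergent_subsequence by blast
  have "convergent (\<lambda>n. a j (r (q n)))" if j: "j \<in> I" for j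
  proof -
    obtain L where "(\<lambda>n. a j (r n)) \<longlonglongrightarrow> L"
      using convergentD[OF bspec[OF r(2) j]] by (rule exE)
    then have "((\<lambda>n. a j (r n)) \<circ> q) \<longlonglongrightarrow> L"
      using q(1) by (rule LIMSEQ_subseq_LIMSEQ)
    then show ?thesis by (auto simp: convergent_def o_def)
  qed
  moreover have "convergent (\<lambda>n. a i (r (q n)))"
    using q(2) by (auto simp: convergent_def o_def)
  moreover have "strict_mono (\<lambda>n. r (q n))"
    using strict_mono_o[OF r(1) q(1)] by (simp add: o_def)
  ultimately show ?case by (intro exI[of _ "\<lambda>n. r (q n)"]) blast
qed

text \<open>\<open>E\<close> is the energy, \<open>L\<close> the \<open>L\<^sup>2\<close> product and \<open>\<phi>\<close> the first eigenfunction. The assumption \<open>gap\<close>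
is what remains of the compact embedding into \<open>L\<^sup>2\<close>: below any level \<open>\<Lambda>\<close> the energy fails to
dominate \<open>\<Lambda> L\<close> only in finitely many directions, those seen by the functionals \<open>f i\<close>. The
assumption \<open>closed\<close> combines completeness in \<open>L\<close> with lower semicontinuity of \<open>E\<close>.\<close>

locale form_pair = E: psd_form V E + L: psd_form V L
  for V :: "('a \<Rightarrow> real) set" and E L +
  fixes \<phi> :: "'a \<Rightarrow> real" and \<mu>\<^sub>1 :: real
  assumes \<phi>_in: "\<phi> \<in> V" and \<phi>_norm: "L \<phi> \<phi> = 1"
    and \<phi>_weak: "v \<in> V \<Longrightarrow> E \<phi> v = \<mu>\<^sub>1 * L \<phi> v"
    and \<mu>\<^sub>1_pos: "\<mu>\<^sub>1 > 0"
    and orthogonal_exists: "\<exists>v\<in>V. L \<phi> v = 0 \<and> L v v > 0"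
    and gap: "\<exists>(f :: nat \<Rightarrow> ('a \<Rightarrow> real) \<Rightarrow> real) m C.
        (\<forall>i<m. (\<forall>u\<in>V. \<forall>v\<in>V. f i (\<lambda>x. u x - v x) = f i u - f i v) \<and>
                (\<exists>D. \<forall>v\<in>V. (f i v)\<^sup>2 \<le> D * L v v)) \<and>
        (\<forall>v\<in>V. \<Lambda> * L v v \<le> E v v + C * (\<Sum>i<m. (f i v)\<^sup>2))"
    and closed: "(\<And>n. u n \<in> V) \<Longrightarrow>
        (\<And>e. e > 0 \<Longrightarrow> \<exists>N. \<forall>m\<ge>N. \<forall>n\<ge>N. L (\<lambda>x. u m x - u n x) (\<lambda>x. u m x - u n x) < e) \<Longrightarrow>
        (\<lambda>n. E (u n) (u n)) \<longlonglongrightarrow> c \<Longrightarrow>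
        \<exists>v\<in>V. (\<lambda>n. L (\<lambda>x. u n x - v x) (\<lambda>x. u n x - v x)) \<longlonglongrightarrow> 0 \<and> E v v \<le> c"
begin

definition perp_sphere :: "('a \<Rightarrow> real) set" where
  "perp_sphere = {v \<in> V. L \<phi> v = 0 \<and> L v v = 1}"

definition \<mu>\<^sub>2 :: real where
  "\<mu>\<^sub>2 = (INF v\<in>perp_sphere. E v v)"

lemma perp_sphere_normalize:
  assumes "v \<in> V" "L \<phi> v = 0" "L v v > 0"
  shows "(\<lambda>x. (1 / sqrt (L v v)) * v x) \<in> perp_sphere"
  unfolding perp_sphere_def mem_Collect_eq
  by (simp only: L.V_scale[OF assms(1)] L.B_scale_quadratic[OF assms(1)]
      L.B_scale_right[OF assms(1) \<phi>_in] assms(2))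
    (use assms(3) in \<open>simp add: power_divide\<close>)

lemma perp_sphere_nonempty: "perp_sphere \<noteq> {}"
  using orthogonal_exists perp_sphere_normalize by blast

lemma \<mu>\<^sub>2_le_sphere: "v \<in> perp_sphere \<Longrightarrow> \<mu>\<^sub>2 \<le> E v v"
  unfolding \<mu>\<^sub>2_def
  by (intro cINF_lower bdd_belowI2[of _ 0]) (auto simp: perp_sphere_def E.B_nonneg)

lemma \<mu>\<^sub>2_le:
  assumes v: "v \<in> V" "L \<phi> v = 0"
  shows "\<mu>\<^sub>2 * L v v \<le> E v v"
proof (cases "L v v = 0")
  case True
  then show ?thesis using E.B_nonneg[OF v(1)] by simp
next
  case False
  then have pos: "L v v > 0" using L.B_nonneg[OF v(1)] by simp
  have "\<mu>\<^sub>2 \<le> (1 / sqrt (L v v))\<^sup>2 * E v v"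
    using \<mu>\<^sub>2_le_sphere[OF perp_sphere_normalize[OF v pos]]
    by (simp only: E.B_scale_quadratic[OF v(1)])
  then show ?thesis using pos by (simp add: power_divide field_simps)
qed

text \<open>Direct method. For a minimizing sequence \<open>u\<close>, the parallelogram law and the minimality of \<open>\<mu>\<^sub>2\<close>
bound \<open>E (u j - u n)\<close> by a null sequence plus \<open>\<mu>\<^sub>2 L (u j - u n)\<close>. The gap inequality at the level
\<open>\<Lambda> = \<mu>\<^sub>2 + 1\<close> absorbs the last term, up to the finitely many functionals, which converge along a
subsequence. So a single level suffices to make the subsequence Cauchy in \<open>L\<close>.\<close>

lemma minimizer_exists: "\<exists>\<psi>\<in>perp_sphere. E \<psi> \<psi> = \<mu>\<^sub>2"
proof -
  have "\<exists>v\<in>perp_sphere. E v v < \<mu>\<^sub>2 + 1 / real (Suc n)" for n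
    using perp_sphere_nonempty unfolding \<mu>\<^sub>2_def
    by (subst cINF_less_iff[symmetric])
      (auto intro!: bdd_belowI2[of _ 0] simp: perp_sphere_def E.B_nonneg)
  then obtain w where w: "\<And>n. w n \<in> perp_sphere"
    "\<And>n. E (w n) (w n) < \<mu>\<^sub>2 + 1 / real (Suc n)" by metis
  obtain f :: "nat \<Rightarrow> ('a \<Rightarrow> real) \<Rightarrow> real" and m :: nat and C where
      f: "\<forall>i<m. (\<forall>u\<in>V. \<forall>v\<in>V. f i (\<lambda>x. u x - v x) = f i u - f i v) \<and>
        (\<exists>D. \<forall>v\<in>V. (f i v)\<^sup>2 \<le> D * L v v)"
      and f_gap: "\<forall>v\<in>V. (\<mu>\<^sub>2 + 1) * L v v \<le> E v v + C * (\<Sum>i<m. (f i v)\<^sup>2)"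
    using gap[of "\<mu>\<^sub>2 + 1"] by (elim exE conjE)
  have f_diff: "f i (\<lambda>x. u x - v x) = f i u - f i v" if "i < m" "u \<in> V" "v \<in> V" for i u v
    using f[rule_format, OF that(1)] that(2,3) by metis
  have f_bound: "\<exists>D. \<forall>v\<in>V. (f i v)\<^sup>2 \<le> D * L v v" if "i < m" for i
    using f[rule_format, OF that] by (rule conjunct2)
  have "bounded (range (\<lambda>n. f i (w n)))" if i: "i < m" for i
  proof -
    obtain D where D: "\<forall>v\<in>V. (f i v)\<^sup>2 \<le> D * L v v" using f_bound[OF i] by (rule exE)
    have "\<bar>f i (w n)\<bar> \<le> sqrt D" for n
      using D[rule_format, of "w n"] w(1)[of n] real_sqrt_le_mono[of "(f i (w n))\<^sup>2" D]
      by (auto simp: perp_sphere_def)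
    then show ?thesis by (auto simp: bounded_iff)
  qed
  then obtain r where r: "strict_mono (r :: nat \<Rightarrow> nat)"
    "\<And>i. i < m \<Longrightarrow> convergent (\<lambda>n. f i (w (r n)))"
    using bounded_family_subsequence[of "{..<m}" "\<lambda>i n. f i (w n)"] by auto
  then obtain l where l: "\<And>i. i < m \<Longrightarrow> (\<lambda>n. f i (w (r n))) \<longlonglongrightarrow> l i"
    unfolding convergent_def by metis
  define u where "u n = w (r n)" for n
  have u: "u n \<in> V" "L \<phi> (u n) = 0" "L (u n) (u n) = 1" for n
    using w(1) by (auto simp: u_def perp_sphere_def)
  have Elim: "(\<lambda>n. E (u n) (u n)) \<longlonglongrightarrow> \<mu>\<^sub>2"
  proof (rule tendsto_sandwich[where f = "\<lambda>_. \<mu>\<^sub>2" and h = "\<lambda>n. \<mu>\<^sub>2 + 1 / real (Suc n)"])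
    show "\<forall>\<^sub>F n in sequentially. \<mu>\<^sub>2 \<le> E (u n) (u n)"
      using \<mu>\<^sub>2_le_sphere[OF w(1)] by (auto simp: u_def)
    have "E (u n) (u n) \<le> \<mu>\<^sub>2 + 1 / real (Suc n)" for n
    proof -
      have "1 / real (Suc (r n)) \<le> 1 / real (Suc n)"
        using seq_suble[OF r(1), of n] by (simp add: frac_le)
      then show ?thesis using w(2)[of "r n"] by (simp add: u_def)
    qed
    then show "\<forall>\<^sub>F n in sequentially. E (u n) (u n) \<le> \<mu>\<^sub>2 + 1 / real (Suc n)" by simp
    show "(\<lambda>n. \<mu>\<^sub>2 + 1 / real (Suc n)) \<longlonglongrightarrow> \<mu>\<^sub>2"
      using tendsto_add[OF tendsto_const LIMSEQ_Suc[OF lim_1_over_n], of \<mu>\<^sub>2] by simp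
  qed simp
  \<comment> \<open>The remainder that bounds the \<open>L\<close>-distance of two members of the subsequence.\<close>
  define R where "R = (\<lambda>(j, n). 2 * (E (u j) (u j) - \<mu>\<^sub>2) + 2 * (E (u n) (u n) - \<mu>\<^sub>2)
      + C * (\<Sum>i<m. (f i (u j) - f i (u n))\<^sup>2))"
  have le_R: "L (\<lambda>x. u j x - u n x) (\<lambda>x. u j x - u n x) \<le> R (j, n)" for j n
  proof -
    let ?d = "\<lambda>x. u j x - u n x" and ?p = "\<lambda>x. u j x + u n x"
    have V: "?d \<in> V" "?p \<in> V" using u by (auto simp: L.V_diff L.V_add)
    have "\<mu>\<^sub>2 * L ?p ?p \<le> E ?p ?p"
      using u \<phi>_in V by (intro \<mu>\<^sub>2_le) (auto simp: L.B_add_right)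
    then have "\<mu>\<^sub>2 * (2 + 2 * L (u j) (u n)) \<le> E (u j) (u j) + 2 * E (u j) (u n) + E (u n) (u n)"
      using u by (simp add: L.B_add_quadratic E.B_add_quadratic)
    moreover have "(\<mu>\<^sub>2 + 1) * L ?d ?d \<le> E ?d ?d + C * (\<Sum>i<m. (f i ?d)\<^sup>2)"
      by (rule bspec[OF f_gap V(1)])
    moreover have "(\<Sum>i<m. (f i ?d)\<^sup>2) = (\<Sum>i<m. (f i (u j) - f i (u n))\<^sup>2)"
      using f_diff u(1) by (intro sum.cong) simp_all
    moreover have "L ?d ?d = 2 - 2 * L (u j) (u n)"
      using u by (simp add: L.B_diff_quadratic)
    moreover have "E ?d ?d = E (u j) (u j) - 2 * E (u j) (u n) + E (u n) (u n)"
      using u by (simp add: E.B_diff_quadratic)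
    ultimately show ?thesis unfolding R_def by (simp add: algebra_simps)
  qed
  have fst_lim: "filterlim (fst :: nat \<times> nat \<Rightarrow> nat) sequentially (sequentially \<times>\<^sub>F sequentially)"
    and snd_lim: "filterlim (snd :: nat \<times> nat \<Rightarrow> nat) sequentially (sequentially \<times>\<^sub>F sequentially)"
    by (rule filterlim_fst filterlim_snd)+
  have "(R \<longlongrightarrow> 2 * (\<mu>\<^sub>2 - \<mu>\<^sub>2) + 2 * (\<mu>\<^sub>2 - \<mu>\<^sub>2) + C * (\<Sum>i<m. (l i - l i)\<^sup>2))
      (sequentially \<times>\<^sub>F sequentially)"
    unfolding R_def case_prod_unfold
    by (intro tendsto_intros filterlim_compose[OF Elim] fst_lim snd_lim
        filterlim_compose[OF l[folded u_def]]) simp_all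
  then have R_lim: "(R \<longlongrightarrow> 0) (sequentially \<times>\<^sub>F sequentially)" by simp
  have cauchy: "\<exists>N. \<forall>m\<ge>N. \<forall>n\<ge>N. L (\<lambda>x. u m x - u n x) (\<lambda>x. u m x - u n x) < e"
    if "e > 0" for e
  proof -
    have "\<forall>\<^sub>F p in sequentially \<times>\<^sub>F sequentially. R p < e"
      using R_lim that by (rule order_tendstoD)
    then show ?thesis
      unfolding eventually_prod_sequentially using le_R by (meson le_less_trans)
  qed
  obtain \<psi> where \<psi>: "\<psi> \<in> V" "E \<psi> \<psi> \<le> \<mu>\<^sub>2"
    and lim: "(\<lambda>n. L (\<lambda>x. u n x - \<psi> x) (\<lambda>x. u n x - \<psi> x)) \<longlonglongrightarrow> 0"
    using closed[of u, OF u(1) cauchy Elim] by blast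
  have "(\<lambda>n. \<bar>L \<phi> \<psi>\<bar>) \<longlonglongrightarrow> 0"
  proof (rule tendsto_sandwich[where f = "\<lambda>_. 0"])
    have "\<bar>L \<phi> \<psi>\<bar> \<le> sqrt (L (\<lambda>x. u n x - \<psi> x) (\<lambda>x. u n x - \<psi> x))" for n
      using real_sqrt_le_mono[OF L.cauchy_schwarz[OF \<phi>_in L.V_diff[OF u(1)[of n] \<psi>(1)]]] u[of n]
      by (simp add: L.B_diff_right \<psi> \<phi>_in \<phi>_norm)
    then show "\<forall>\<^sub>F n in sequentially. \<bar>L \<phi> \<psi>\<bar>
        \<le> sqrt (L (\<lambda>x. u n x - \<psi> x) (\<lambda>x. u n x - \<psi> x))" by simp
    show "(\<lambda>n. sqrt (L (\<lambda>x. u n x - \<psi> x) (\<lambda>x. u n x - \<psi> x))) \<longlonglongrightarrow> 0"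
      using tendsto_real_sqrt[OF lim] by simp
  qed auto
  then have perp: "L \<phi> \<psi> = 0" by (simp add: LIMSEQ_const_iff)
  have "(\<lambda>n. \<bar>1 - sqrt (L \<psi> \<psi>)\<bar>) \<longlonglongrightarrow> 0"
  proof (rule tendsto_sandwich[where f = "\<lambda>_. 0"])
    have "\<bar>1 - sqrt (L \<psi> \<psi>)\<bar> \<le> sqrt (L (\<lambda>x. u n x - \<psi> x) (\<lambda>x. u n x - \<psi> x))" for n
      using L.sqrt_B_diff_le[OF u(1)[of n] \<psi>(1)] u(3) by simp
    then show "\<forall>\<^sub>F n in sequentially. \<bar>1 - sqrt (L \<psi> \<psi>)\<bar>
        \<le> sqrt (L (\<lambda>x. u n x - \<psi> x) (\<lambda>x. u n x - \<psi> x))" by simp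
    show "(\<lambda>n. sqrt (L (\<lambda>x. u n x - \<psi> x) (\<lambda>x. u n x - \<psi> x))) \<longlonglongrightarrow> 0"
      using tendsto_real_sqrt[OF lim] by simp
  qed auto
  then have "L \<psi> \<psi> = 1" by (simp add: LIMSEQ_const_iff)
  with perp \<psi> have "\<psi> \<in> perp_sphere" by (simp add: perp_sphere_def)
  with \<psi>(2) \<mu>\<^sub>2_le_sphere show ?thesis by force
qed

text \<open>On the orthogonal complement of \<open>\<phi>\<close> the form \<open>E - \<mu>\<^sub>2 L\<close> is positive semidefinite and vanishes at
\<open>\<psi>\<close>, so Cauchy--Schwarz gives the weak equation for test functions orthogonal to \<open>\<phi>\<close>. In the
direction \<open>\<phi>\<close> itself both sides are zero by the equation for \<open>\<phi>\<close>.\<close>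

lemma minimizer_weak:
  assumes \<psi>: "\<psi> \<in> perp_sphere" "E \<psi> \<psi> = \<mu>\<^sub>2" and v: "v \<in> V"
  shows "E \<psi> v = \<mu>\<^sub>2 * L \<psi> v"
proof -
  have \<psi>V: "\<psi> \<in> V" "L \<phi> \<psi> = 0" "L \<psi> \<psi> = 1" using \<psi> by (auto simp: perp_sphere_def)
  interpret D: psd_form "{v \<in> V. L \<phi> v = 0}" "\<lambda>u v. E u v - \<mu>\<^sub>2 * L u v"
    using \<mu>\<^sub>2_le
    by unfold_locales (auto simp: L.V_lin L.B_lin_right E.B_lin L.B_lin \<phi>_in algebra_simps
        L.B_sym E.B_sym)
  have orth: "E \<psi> w = \<mu>\<^sub>2 * L \<psi> w" if "w \<in> V" "L \<phi> w = 0" for w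
    using D.cauchy_schwarz[of \<psi> w] \<psi>(2) \<psi>V that by simp
  define c where "c = L \<phi> v"
  let ?w = "\<lambda>x. 1 * v x + (- c) * \<phi> x"
  have "?w \<in> V" "L \<phi> ?w = 0"
    using L.V_lin[OF v \<phi>_in] L.B_lin_right[OF v \<phi>_in \<phi>_in, of 1 "- c"]
    by (simp_all only: \<phi>_norm c_def)
  from orth[OF this] have "E \<psi> v - c * E \<psi> \<phi> = \<mu>\<^sub>2 * (L \<psi> v - c * L \<psi> \<phi>)"
    by (simp only: L.B_lin_right[OF v \<phi>_in \<psi>V(1)] E.B_lin_right[OF v \<phi>_in \<psi>V(1)]) simp
  moreover have "L \<psi> \<phi> = 0" "E \<psi> \<phi> = 0"
    using \<psi>V \<phi>_in \<phi>_weak[OF \<psi>V(1)] by (auto simp: L.B_sym[of \<psi> \<phi>] E.B_sym[of \<psi> \<phi>])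
  ultimately show ?thesis by simp
qed

text \<open>Eigenfunctions of different eigenvalues are orthogonal, so \<open>u\<close> competes in the definition of \<open>\<mu>\<^sub>2\<close>.\<close>

lemma eigenvalue_ge_\<mu>\<^sub>2:
  assumes u: "u \<in> V" "L u u > 0" and weak: "\<And>v. v \<in> V \<Longrightarrow> E u v = \<mu> * L u v" and "\<mu> \<noteq> \<mu>\<^sub>1"
  shows "\<mu>\<^sub>2 \<le> \<mu>"
proof -
  have "\<mu> * L \<phi> u = \<mu>\<^sub>1 * L \<phi> u"
    using weak[OF \<phi>_in] \<phi>_weak[OF u(1)] L.B_sym[OF u(1) \<phi>_in] E.B_sym[OF u(1) \<phi>_in] by metis
  then have "L \<phi> u = 0" using \<open>\<mu> \<noteq> \<mu>\<^sub>1\<close> by (metis mult_right_cancel)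
  from \<mu>\<^sub>2_le[OF u(1) this] weak[OF u(1)] u(2) show ?thesis by simp
qed

lemma continuous_energy_path:
  assumes "\<And>t. t \<in> T \<Longrightarrow> \<gamma> t \<in> V"
    and "\<And>t. t \<in> T \<Longrightarrow>
      ((\<lambda>t'. sqrt (E (\<lambda>x. \<gamma> t' x - \<gamma> t x) (\<lambda>x. \<gamma> t' x - \<gamma> t x))) \<longlongrightarrow> 0) (at t within T)"
  shows "continuous_on T (\<lambda>t. E (\<gamma> t) (\<gamma> t))"
proof -
  have "continuous_on T (\<lambda>t. sqrt (E (\<gamma> t) (\<gamma> t)))"
    unfolding continuous_on
  proof
    fix t assume t: "t \<in> T"
    have "((\<lambda>t'. sqrt (E (\<gamma> t') (\<gamma> t')) - sqrt (E (\<gamma> t) (\<gamma> t))) \<longlongrightarrow> 0) (at t within T)"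
      by (rule Lim_null_comparison[OF _ assms(2)[OF t]])
        (auto simp: eventually_at_filter assms(1) t intro!: always_eventually E.sqrt_B_diff_le)
    then show "((\<lambda>t'. sqrt (E (\<gamma> t') (\<gamma> t'))) \<longlongrightarrow> sqrt (E (\<gamma> t) (\<gamma> t))) (at t within T)"
      by (simp add: LIM_zero_iff)
  qed
  then have "continuous_on T (\<lambda>t. (sqrt (E (\<gamma> t) (\<gamma> t)))\<^sup>2)"
    by (rule continuous_on_power)
  then show ?thesis
    by (rule continuous_on_eq) (use E.B_nonneg assms(1) in force)
qed

text \<open>By the weak equation \<open>L \<phi> (\<gamma> t)\<close> is \<open>E \<phi> (\<gamma> t) / \<mu>\<^sub>1\<close>, which is continuous along a path that is
continuous in the energy norm; the intermediate value theorem applies.\<close>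

lemma path_crosses_perp:
  fixes \<gamma> :: "real \<Rightarrow> 'a \<Rightarrow> real"
  assumes V: "\<And>t. t \<in> {a..b} \<Longrightarrow> \<gamma> t \<in> V"
    and cont: "\<And>t. t \<in> {a..b} \<Longrightarrow>
      ((\<lambda>t'. sqrt (E (\<lambda>x. \<gamma> t' x - \<gamma> t x) (\<lambda>x. \<gamma> t' x - \<gamma> t x))) \<longlongrightarrow> 0) (at t within {a..b})"
    and ab: "a \<le> b" "L \<phi> (\<gamma> a) \<le> 0" "L \<phi> (\<gamma> b) \<ge> 0"
  shows "\<exists>t\<in>{a..b}. L \<phi> (\<gamma> t) = 0"
proof -
  have "continuous_on {a..b} (\<lambda>t. E \<phi> (\<gamma> t))"
    unfolding continuous_on
  proof
    fix t assume t: "t \<in> {a..b}"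
    have "\<bar>E \<phi> (\<gamma> t') - E \<phi> (\<gamma> t)\<bar>
        \<le> sqrt (E \<phi> \<phi>) * sqrt (E (\<lambda>x. \<gamma> t' x - \<gamma> t x) (\<lambda>x. \<gamma> t' x - \<gamma> t x))"
      if "t' \<in> {a..b}" for t'
      using real_sqrt_le_mono[OF E.cauchy_schwarz[OF \<phi>_in E.V_diff[OF V[OF that] V[OF t]]]]
        V[OF that] V[OF t] \<phi>_in by (simp add: E.B_diff_right real_sqrt_mult)
    then have "\<forall>\<^sub>F t' in at t within {a..b}. norm (E \<phi> (\<gamma> t') - E \<phi> (\<gamma> t))
        \<le> sqrt (E \<phi> \<phi>) * sqrt (E (\<lambda>x. \<gamma> t' x - \<gamma> t x) (\<lambda>x. \<gamma> t' x - \<gamma> t x))"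
      by (simp add: eventually_at_filter)
    moreover have "((\<lambda>t'. sqrt (E \<phi> \<phi>) * sqrt (E (\<lambda>x. \<gamma> t' x - \<gamma> t x) (\<lambda>x. \<gamma> t' x - \<gamma> t x)))
        \<longlongrightarrow> 0) (at t within {a..b})"
      using tendsto_mult_left[OF cont[OF t]] by simp
    ultimately have "((\<lambda>t'. E \<phi> (\<gamma> t') - E \<phi> (\<gamma> t)) \<longlongrightarrow> 0) (at t within {a..b})"
      by (rule Lim_null_comparison)
    then show "((\<lambda>t'. E \<phi> (\<gamma> t')) \<longlongrightarrow> E \<phi> (\<gamma> t)) (at t within {a..b})"
      by (simp add: LIM_zero_iff)
  qed
  moreover have "E \<phi> (\<gamma> a) \<le> 0" "E \<phi> (\<gamma> b) \<ge> 0"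
    using ab V \<mu>\<^sub>1_pos by (auto simp: \<phi>_weak mult_le_0_iff)
  ultimately obtain t where "t \<in> {a..b}" "E \<phi> (\<gamma> t) = 0"
    using IVT'[of "\<lambda>t. E \<phi> (\<gamma> t)" a 0 b] ab(1) by auto
  with \<mu>\<^sub>1_pos V show ?thesis by (auto simp: \<phi>_weak)
qed

end

section \<open>Lebesgue measurability on product spaces\<close>

lemma borel_measurable_lebesgue_AE_cong:
  fixes f g :: "'a::euclidean_space \<Rightarrow> real"
  assumes g: "g \<in> borel_measurable lebesgue" and eq: "AE x in lborel. f x = g x"
  shows "f \<in> borel_measurable lebesgue"
proof (rule borel_measurableI)
  fix S :: "real set" assume "open S"
  then have "g -` S \<inter> space lebesgue \<in> sets lebesgue"
    by (intro measurable_sets[OF g]) simp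
  moreover have "AE x in lebesgue. x \<in> g -` S \<inter> space lebesgue \<longleftrightarrow> x \<in> f -` S \<inter> space lebesgue"
    using AE_completion[OF eq] by eventually_elim simp
  ultimately show "f -` S \<inter> space lebesgue \<in> sets lebesgue"
    by (rule completion.in_sets_AE[OF _ _ Int_lower2, rotated])
qed

lemma AE_lborel_fst:
  assumes "AE x in lborel. P (x :: 'a::euclidean_space)"
  shows "AE p in (lborel :: ('a \<times> 'b::euclidean_space) measure). P (fst p)"
proof -
  obtain N where N: "{x. \<not> P x} \<subseteq> N" "N \<in> null_sets lborel"
    using assms unfolding eventually_ae_filter by auto
  have "N \<times> UNIV \<in> null_sets (lborel :: ('a \<times> 'b) measure)"
    using lborel.times_in_null_sets1[OF N(2), of "UNIV :: 'b set"] by (simp add: lborel_prod)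
  then show ?thesis
    by (rule AE_I') (use N in auto)
qed

lemma AE_lborel_snd:
  assumes "AE x in lborel. P (x :: 'b::euclidean_space)"
  shows "AE p in (lborel :: ('a::euclidean_space \<times> 'b) measure). P (snd p)"
proof -
  obtain N where N: "{x. \<not> P x} \<subseteq> N" "N \<in> null_sets lborel"
    using assms unfolding eventually_ae_filter by auto
  have "UNIV \<times> N \<in> null_sets (lborel :: ('a \<times> 'b) measure)"
    using lborel.times_in_null_sets2[OF _ N(2), of "UNIV :: 'a set" lborel] by (simp add: lborel_prod)
  then show ?thesis
    by (rule AE_I') (use N in auto)
qed

text \<open>Every horizontal section \<open>{x. x - y \<in> N}\<close> is a translate of \<open>N\<close>, hence null when \<open>N\<close> is. This is what
makes \<open>K (x - y)\<close> measurable for a kernel \<open>K\<close> that is only Lebesgue measurable.\<close>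

lemma AE_lborel_diff:
  assumes "AE x in lborel. P (x :: 'a::euclidean_space)"
  shows "AE p in (lborel :: ('a \<times> 'a) measure). P (fst p - snd p)"
proof -
  obtain N where N: "{x. \<not> P x} \<subseteq> N" "N \<in> null_sets lborel"
    using assms unfolding eventually_ae_filter by auto
  then have [measurable]: "N \<in> sets borel" by auto
  have *: "AE x in lborel. x - y \<notin> N" for y
  proof -
    have "AE x in distr lborel borel ((+) (- y)). x \<notin> N"
      unfolding lborel_distr_plus by (rule AE_not_in[OF N(2)])
    then show ?thesis
      by (subst (asm) AE_distr_iff) (auto simp: algebra_simps)
  qed
  have "AE y in lborel. AE x in lborel. x - y \<notin> N" by (simp add: *)
  then have "AE x in lborel. AE y in lborel. x - y \<notin> N"
    by (subst (asm) lborel_pair.AE_commute) measurable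
  moreover have "{p \<in> space (lborel \<Otimes>\<^sub>M lborel). fst p - snd p \<notin> N} \<in> sets (lborel \<Otimes>\<^sub>M lborel)"
    by measurable
  ultimately have "AE p in lborel \<Otimes>\<^sub>M lborel. fst p - snd p \<notin> N"
    by (intro lborel_pair.AE_pair_measure) simp_all
  then have "AE p in (lborel :: ('a \<times> 'a) measure). fst p - snd p \<notin> N"
    by (simp only: lborel_prod)
  then show ?thesis
    by (rule AE_mp) (use N in auto)
qed

text \<open>\<open>f\<close> agrees with a Borel function off a null set, and the assumption \<open>AE\<close> makes the preimage of that
null set null.\<close>

lemma borel_measurable_lebesgue_compose:
  fixes f :: "'a::euclidean_space \<Rightarrow> real" and T :: "'b::euclidean_space \<Rightarrow> 'a"
  assumes f: "f \<in> borel_measurable lebesgue" and T: "T \<in> borel_measurable borel"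
    and AE: "\<And>P. (AE x in lborel. P x) \<Longrightarrow> (AE p in lborel. P (T p))"
  shows "(\<lambda>p. f (T p)) \<in> borel_measurable lebesgue"
proof -
  obtain g where g: "g \<in> borel_measurable borel" "AE x in lborel. f x = g x"
    using completion_ex_borel_measurable_real[OF f] by auto
  have "(\<lambda>p. g (T p)) \<in> borel_measurable lebesgue"
    using measurable_compose[OF T g(1)] by (intro measurable_completion) simp
  then show ?thesis
    by (rule borel_measurable_lebesgue_AE_cong) (rule AE[OF g(2)])
qed

lemma borel_measurable_lebesgue_fst:
  fixes f :: "'a::euclidean_space \<Rightarrow> real"
  assumes "f \<in> borel_measurable lebesgue"
  shows "(\<lambda>p. f (fst p)) \<in> borel_measurable (lebesgue :: ('a \<times> 'b::euclidean_space) measure)"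
  by (rule borel_measurable_lebesgue_compose[OF assms _ AE_lborel_fst]) (simp add: borel_prod[symmetric])

lemma borel_measurable_lebesgue_snd:
  fixes f :: "'b::euclidean_space \<Rightarrow> real"
  assumes "f \<in> borel_measurable lebesgue"
  shows "(\<lambda>p. f (snd p)) \<in> borel_measurable (lebesgue :: ('a::euclidean_space \<times> 'b) measure)"
  by (rule borel_measurable_lebesgue_compose[OF assms _ AE_lborel_snd]) (simp add: borel_prod[symmetric])

lemma borel_measurable_lebesgue_diff:
  fixes f :: "'a::euclidean_space \<Rightarrow> real"
  assumes "f \<in> borel_measurable lebesgue"
  shows "(\<lambda>p. f (fst p - snd p)) \<in> borel_measurable (lebesgue :: ('a \<times> 'a) measure)"
  by (rule borel_measurable_lebesgue_compose[OF assms _ AE_lborel_diff])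
    (simp add: borel_prod[symmetric])

lemma set_borel_measurable_lebesgue:
  fixes f :: "'a::euclidean_space \<Rightarrow> real"
  assumes "f \<in> borel_measurable lebesgue" "A \<in> sets lebesgue"
  shows "set_borel_measurable lebesgue A f"
  unfolding set_borel_measurable_def using assms by measurable

lemma L2_on_mult_integrable:
  assumes f: "L2_on A f" and g: "L2_on A g"
  shows "set_integrable lebesgue A (\<lambda>x. f x * g x)"
proof -
  let ?f = "\<lambda>x. indicator A x * f x" and ?g = "\<lambda>x. indicator A x * g x"
  have [measurable]: "?f \<in> borel_measurable lebesgue" "?g \<in> borel_measurable lebesgue"
    using f g by (auto simp: L2_on_def set_borel_measurable_def)
  have "integrable lebesgue (\<lambda>x. ?f x * ?g x)"
  proof (rule Bochner_Integration.integrable_bound)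
    show "integrable lebesgue (\<lambda>x. indicator A x *\<^sub>R (f x)\<^sup>2 + indicator A x *\<^sub>R (g x)\<^sup>2)"
      using f g by (auto simp: L2_on_def set_integrable_def)
    have "\<bar>a * b\<bar> \<le> a\<^sup>2 + b\<^sup>2" for a b :: real
      using sum_squares_bound[of "\<bar>a\<bar>" "\<bar>b\<bar>"] mult_nonneg_nonneg[of "\<bar>a\<bar>" "\<bar>b\<bar>"]
      unfolding abs_mult power2_abs by linarith
    then show "AE x in lebesgue. norm (?f x * ?g x)
        \<le> norm (indicator A x *\<^sub>R (f x)\<^sup>2 + indicator A x *\<^sub>R (g x)\<^sup>2)"
      by (intro AE_I2) (auto simp: indicator_def)
  qed measurable
  then show ?thesis
    unfolding set_integrable_def
    by (rule Bochner_Integration.integrable_cong[THEN iffD1, rotated -1])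
      (auto simp: indicator_def)
qed

lemma L2_on_linear:
  assumes f: "L2_on A f" and g: "L2_on A g"
  shows "L2_on A (\<lambda>x. a * f x + b * g x)"
proof -
  have "set_borel_measurable lebesgue A (\<lambda>x. a * f x + b * g x)"
    using f g unfolding L2_on_def set_borel_measurable_def
    by (auto simp: algebra_simps intro!: borel_measurable_add)
  moreover have "set_integrable lebesgue A
      (\<lambda>x. a\<^sup>2 * (f x)\<^sup>2 + (2 * a * b) * (f x * g x) + b\<^sup>2 * (g x)\<^sup>2)"
    using f g L2_on_mult_integrable[OF f g]
    by (auto simp: L2_on_def intro!: set_integral_add set_integrable_mult_right)
  ultimately show ?thesis
    by (simp add: L2_on_def power2_eq_square algebra_simps)
qed

section \<open>The energy form and the space of admissible functions\<close>

locale kernel_problem =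
  fixes s :: real and \<Omega> :: "(real ^ 'n) set" and K :: "real ^ 'n \<Rightarrow> real"
  assumes s_pos: "0 < s"
    and \<Omega>_open: "open \<Omega>" and \<Omega>_bounded: "bounded \<Omega>" and \<Omega>_nonempty: "\<Omega> \<noteq> {}"
    and kernel: "admissible_kernel s K"
begin

abbreviation X\<^sub>0 where "X\<^sub>0 \<equiv> X0_space K \<Omega>"
abbreviation Q where "Q \<equiv> Q_set \<Omega>"

text \<open>With this function the energy form is an inner product in \<open>L\<^sup>2(Q)\<close>, so that bilinearity and
integrability come from \<open>L\<^sup>2\<close> theory.\<close>

definition weighted_diff :: "(real ^ 'n \<Rightarrow> real) \<Rightarrow> (real ^ 'n) \<times> (real ^ 'n) \<Rightarrow> real" where
  "weighted_diff u = (\<lambda>(x, y). (u x - u y) * sqrt (K (x - y)))"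

definition energy_form :: "(real ^ 'n \<Rightarrow> real) \<Rightarrow> (real ^ 'n \<Rightarrow> real) \<Rightarrow> real" where
  "energy_form u v = (LINT (x, y):Q|lebesgue. (u x - u y) * (v x - v y) * K (x - y))"

definition L2_form :: "(real ^ 'n \<Rightarrow> real) \<Rightarrow> (real ^ 'n \<Rightarrow> real) \<Rightarrow> real" where
  "L2_form u v = (LINT x:\<Omega>|lebesgue. u x * v x)"

lemma K_pos: "x \<noteq> 0 \<Longrightarrow> K x > 0"
  using kernel unfolding admissible_kernel_def by blast

lemma K_lower: obtains c where "c > 0"
  "\<And>x. x \<noteq> 0 \<Longrightarrow> K x \<ge> c * norm x powr (- (real CARD('n) + 2 * s))"
proof -
  have "\<exists>c. c > 0 \<and> (\<forall>x. x \<noteq> 0 \<longrightarrow> K x \<ge> c * norm x powr (- (real CARD('n) + 2 * s)))"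
    using kernel unfolding admissible_kernel_def by (elim conjE)
  then obtain c where "c > 0 \<and> (\<forall>x. x \<noteq> 0 \<longrightarrow> K x \<ge> c * norm x powr (- (real CARD('n) + 2 * s)))"
    by (rule exE)
  then show thesis by (intro that[of c]) simp_all
qed

lemma K_integrable: "integrable lebesgue (\<lambda>x. min ((norm x)\<^sup>2) 1 * K x)"
  using kernel unfolding admissible_kernel_def by blast

lemma norm_square_measurable: "(\<lambda>x::real^'n. min ((norm x)\<^sup>2) 1) \<in> borel_measurable lebesgue"
  by (intro measurable_completion) simp

text \<open>\<open>K\<close> is recovered from the integrable function \<open>m K\<close> by dividing by \<open>m\<close>, which is zero only at the
origin.\<close>

lemma K_measurable: "K \<in> borel_measurable lebesgue"
proof (rule borel_measurable_lebesgue_AE_cong)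
  show "(\<lambda>x. (min ((norm x)\<^sup>2) 1 * K x) / min ((norm x)\<^sup>2) 1) \<in> borel_measurable lebesgue"
    by (rule borel_measurable_divide[OF borel_measurable_integrable[OF K_integrable]
          norm_square_measurable])
  have "AE x in lborel. x \<noteq> (0 :: real ^ 'n)"
    by (rule AE_lborel_singleton)
  then show "AE x in lborel. K x = (min ((norm x)\<^sup>2) 1 * K x) / min ((norm x)\<^sup>2) 1"
    by eventually_elim (simp add: min_def)
qed

lemma Q_measurable: "Q \<in> sets lebesgue"
proof -
  have "Q = \<Omega> \<times> UNIV \<union> UNIV \<times> \<Omega>" by (auto simp: Q_set_def)
  then have "open Q" using \<Omega>_open by (simp add: open_Times open_Un)
  then show ?thesis by (intro sets_completionI_sets) simp
qed

lemma \<Omega>_measurable: "\<Omega> \<in> sets lebesgue"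
  using \<Omega>_open by (intro sets_completionI_sets) simp

lemma weighted_diff_measurable:
  assumes u: "u \<in> borel_measurable lebesgue"
  shows "weighted_diff u \<in> borel_measurable lebesgue"
proof -
  note [measurable] = borel_measurable_lebesgue_fst[OF u] borel_measurable_lebesgue_snd[OF u]
    borel_measurable_lebesgue_diff[OF K_measurable]
  have "(\<lambda>p. (u (fst p) - u (snd p)) * sqrt (K (fst p - snd p))) \<in> borel_measurable lebesgue"
    by measurable
  then show ?thesis by (simp add: weighted_diff_def case_prod_unfold)
qed

text \<open>On the diagonal both sides vanish, whatever the sign of \<open>K 0\<close>.\<close>

lemma weighted_diff_mult:
  "weighted_diff u p * weighted_diff v p = (case p of (x, y) \<Rightarrow> (u x - u y) * (v x - v y) * K (x - y))"
proof (cases p)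
  case (Pair x y)
  show ?thesis
  proof (cases "x = y")
    case False
    then have "sqrt (K (x - y)) * sqrt (K (x - y)) = K (x - y)"
      using K_pos[of "x - y"] by simp
    then show ?thesis unfolding Pair weighted_diff_def by (simp add: mult_ac)
  qed (simp add: Pair weighted_diff_def)
qed

lemma energy_form_eq: "energy_form u v = (LINT p:Q|lebesgue. weighted_diff u p * weighted_diff v p)"
  unfolding energy_form_def weighted_diff_mult ..

lemma energy_eq: "energy K \<Omega> u = energy_form u u"
  by (simp add: energy_def energy_form_def power2_eq_square)

lemma weighted_diff_linear:
  "weighted_diff (\<lambda>x. a * u x + b * v x) = (\<lambda>p. a * weighted_diff u p + b * weighted_diff v p)"
  by (auto simp: weighted_diff_def algebra_simps)

lemma X\<^sub>0_iff:
  "u \<in> X\<^sub>0 \<longleftrightarrow> u \<in> borel_measurable lebesgue \<and> L2_on \<Omega> u \<and> L2_on Q (weighted_diff u)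
     \<and> (AE x in lebesgue. x \<notin> \<Omega> \<longrightarrow> u x = 0)"
  by (auto simp: X0_space_def X_space_def weighted_diff_def)

lemma X\<^sub>0_I:
  assumes u: "u \<in> borel_measurable lebesgue"
    and "set_integrable lebesgue \<Omega> (\<lambda>x. (u x)\<^sup>2)"
    and "set_integrable lebesgue Q (\<lambda>p. (weighted_diff u p)\<^sup>2)"
    and "AE x in lebesgue. x \<notin> \<Omega> \<longrightarrow> u x = 0"
  shows "u \<in> X\<^sub>0"
  using assms set_borel_measurable_lebesgue[OF u \<Omega>_measurable]
    set_borel_measurable_lebesgue[OF weighted_diff_measurable[OF u] Q_measurable]
  by (simp add: X\<^sub>0_iff L2_on_def)

lemma X\<^sub>0_linear:
  assumes "u \<in> X\<^sub>0" "v \<in> X\<^sub>0"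
  shows "(\<lambda>x. a * u x + b * v x) \<in> X\<^sub>0"
  unfolding X\<^sub>0_iff
proof (intro conjI)
  show "(\<lambda>x. a * u x + b * v x) \<in> borel_measurable lebesgue"
    using assms by (auto simp: X\<^sub>0_iff)
  show "L2_on \<Omega> (\<lambda>x. a * u x + b * v x)"
    using assms by (auto simp: X\<^sub>0_iff intro: L2_on_linear)
  show "L2_on Q (weighted_diff (\<lambda>x. a * u x + b * v x))"
    using assms by (auto simp: X\<^sub>0_iff weighted_diff_linear intro: L2_on_linear)
  have "AE x in lebesgue. x \<notin> \<Omega> \<longrightarrow> u x = 0" "AE x in lebesgue. x \<notin> \<Omega> \<longrightarrow> v x = 0"
    using assms by (auto simp: X\<^sub>0_iff)
  then show "AE x in lebesgue. x \<notin> \<Omega> \<longrightarrow> a * u x + b * v x = 0"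
    by eventually_elim simp
qed

lemma energy_integrable:
  "u \<in> X\<^sub>0 \<Longrightarrow> v \<in> X\<^sub>0 \<Longrightarrow> set_integrable lebesgue Q (\<lambda>p. weighted_diff u p * weighted_diff v p)"
  by (auto simp: X\<^sub>0_iff intro: L2_on_mult_integrable)

lemma L2_integrable:
  "u \<in> X\<^sub>0 \<Longrightarrow> v \<in> X\<^sub>0 \<Longrightarrow> set_integrable lebesgue \<Omega> (\<lambda>x. u x * v x)"
  by (auto simp: X\<^sub>0_iff intro: L2_on_mult_integrable)

sublocale E: psd_form X\<^sub>0 energy_form
proof
  fix u v w :: "real ^ 'n \<Rightarrow> real" and a b :: real
  assume uv: "u \<in> X\<^sub>0" "v \<in> X\<^sub>0" and w: "w \<in> X\<^sub>0"
  have "energy_form (\<lambda>x. a * u x + b * v x) w =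
      (LINT p:Q|lebesgue. a * (weighted_diff u p * weighted_diff w p) + b * (weighted_diff v p * weighted_diff w p))"
    unfolding energy_form_eq weighted_diff_linear by (simp add: algebra_simps)
  also have "\<dots> = a * energy_form u w + b * energy_form v w"
    unfolding energy_form_eq using uv w
    by (simp add: set_integral_add energy_integrable set_integrable_mult_right)
  finally show "energy_form (\<lambda>x. a * u x + b * v x) w = a * energy_form u w + b * energy_form v w" .
next
  fix u assume "u \<in> X\<^sub>0"
  show "energy_form u u \<ge> 0"
    unfolding energy_form_eq set_lebesgue_integral_def by (rule integral_nonneg_AE) simp
qed (auto simp: X\<^sub>0_linear energy_form_eq mult.commute)

sublocale L: psd_form X\<^sub>0 L2_form
proof
  fix u v w :: "real ^ 'n \<Rightarrow> real" and a b :: real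
  assume uv: "u \<in> X\<^sub>0" "v \<in> X\<^sub>0" and w: "w \<in> X\<^sub>0"
  have "L2_form (\<lambda>x. a * u x + b * v x) w = (LINT x:\<Omega>|lebesgue. a * (u x * w x) + b * (v x * w x))"
    unfolding L2_form_def by (simp add: algebra_simps)
  also have "\<dots> = a * L2_form u w + b * L2_form v w"
    unfolding L2_form_def using uv w
    by (simp add: set_integral_add L2_integrable set_integrable_mult_right)
  finally show "L2_form (\<lambda>x. a * u x + b * v x) w = a * L2_form u w + b * L2_form v w" .
next
  fix u assume "u \<in> X\<^sub>0"
  show "L2_form u u \<ge> 0"
    unfolding L2_form_def set_lebesgue_integral_def by (rule integral_nonneg_AE) simp
qed (auto simp: X\<^sub>0_linear L2_form_def mult.commute)

end

section \<open>Lower bounds for the energy on blocks\<close>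

lemma integrable_tensor:
  fixes f :: "'a::euclidean_space \<Rightarrow> real" and g :: "'b::euclidean_space \<Rightarrow> real"
  assumes f: "integrable lborel f" and g: "integrable lborel g"
  shows "integrable lborel (\<lambda>p. f (fst p) * g (snd p))"
    and "(LINT p|lborel. f (fst p) * g (snd p)) = (LINT x|lborel. f x) * (LINT y|lborel. g y)"
proof -
  have [measurable]: "f \<in> borel_measurable borel" "g \<in> borel_measurable borel"
    using borel_measurable_integrable[OF f] borel_measurable_integrable[OF g] by auto
  have int: "integrable (lborel \<Otimes>\<^sub>M lborel) (\<lambda>p. f (fst p) * g (snd p))"
  proof (rule lborel_pair.Fubini_integrable)
    show "integrable lborel (\<lambda>x. LINT y|lborel. norm (f (fst (x, y)) * g (snd (x, y))))"
      using f by (simp add: abs_mult)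
    show "AE x in lborel. integrable lborel (\<lambda>y. f (fst (x, y)) * g (snd (x, y)))"
      using g by simp
  qed measurable
  then show "integrable lborel (\<lambda>p. f (fst p) * g (snd p))"
    by (simp only: lborel_prod)
  show "(LINT p|lborel. f (fst p) * g (snd p)) = (LINT x|lborel. f x) * (LINT y|lborel. g y)"
    using lborel_pair.integral_fst'[OF int] by (simp add: lborel_prod)
qed

text \<open>The variance identity: expanding the square gives three products of a function of \<open>x\<close> and a function
of \<open>y\<close>, each integrated by Fubini.\<close>

lemma integral_square_differences:
  fixes f :: "'a::euclidean_space \<Rightarrow> real"
  assumes f: "f \<in> borel_measurable lebesgue"
    and A: "A \<in> sets borel" "emeasure lborel A < \<infinity>"
    and f2: "set_integrable lebesgue A (\<lambda>x. (f x)\<^sup>2)"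
  shows "set_integrable lebesgue A f"
    and "integrable lebesgue (\<lambda>p. indicator (A \<times> A) p * (f (fst p) - f (snd p))\<^sup>2)"
    and "(LINT p|lebesgue. indicator (A \<times> A) p * (f (fst p) - f (snd p))\<^sup>2)
      = 2 * measure lborel A * (LINT x:A|lebesgue. (f x)\<^sup>2) - 2 * (LINT x:A|lebesgue. f x)\<^sup>2"
proof -
  obtain g where [measurable]: "g \<in> borel_measurable borel" and fg: "AE x in lborel. f x = g x"
    using completion_ex_borel_measurable_real[OF f] by auto
  note [measurable] = A(1)
  define h where "h x = indicator A x * g x" for x
  define a :: "'a \<Rightarrow> real" where "a x = indicator A x" for x
  have [measurable]: "h \<in> borel_measurable borel" "a \<in> borel_measurable borel"
    unfolding h_def[abs_def] a_def[abs_def] by measurable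
  have fh: "AE x in lborel. indicator A x * f x = h x"
    using fg by eventually_elim (simp add: h_def)
  have m_f [measurable]: "f \<in> borel_measurable lebesgue" by (rule f)
  have A' [measurable]: "A \<in> sets lebesgue" using A(1) by (intro sets_completionI_sets) simp
  have h_leb: "h \<in> borel_measurable lebesgue" by (intro measurable_completion) simp
  have h2_leb: "(\<lambda>x. (h x)\<^sup>2) \<in> borel_measurable lebesgue" by (intro measurable_completion) simp
  have f2_eq: "AE x in lebesgue. indicator A x *\<^sub>R (f x)\<^sup>2 = (h x)\<^sup>2"
    using AE_completion[OF fg] by eventually_elim (simp add: h_def indicator_def)
  have f1_eq: "AE x in lebesgue. indicator A x *\<^sub>R f x = h x"
    using AE_completion[OF fg] by eventually_elim (simp add: h_def indicator_def)
  have h2: "integrable lborel (\<lambda>x. (h x)\<^sup>2)"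
  proof -
    have "integrable lebesgue (\<lambda>x. (h x)\<^sup>2)"
      using f2 unfolding set_integrable_def
      by (rule Bochner_Integration.integrable_cong_AE[THEN iffD1, rotated -1, OF _ _ h2_leb f2_eq])
        measurable
    then show ?thesis by (subst (asm) integrable_completion) simp_all
  qed
  have a: "integrable lborel a"
    unfolding a_def[abs_def] using A by (intro integrable_real_indicator) auto
  have h: "integrable lborel h"
  proof (rule Bochner_Integration.integrable_bound)
    show "integrable lborel (\<lambda>x. a x + (h x)\<^sup>2)" using a h2 by simp
    have "\<bar>t\<bar> \<le> 1 + t\<^sup>2" for t :: real
      using sum_squares_bound[of "\<bar>t\<bar>" 1] by simp
    then show "AE x in lborel. norm (h x) \<le> norm (a x + (h x)\<^sup>2)"
      by (intro AE_I2) (auto simp: h_def a_def indicator_def)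
  qed simp
  have "integrable lebesgue h" using h by (subst integrable_completion) simp_all
  then show "set_integrable lebesgue A f"
    unfolding set_integrable_def
    by (rule Bochner_Integration.integrable_cong_AE[THEN iffD2, rotated -1, OF _ _ h_leb f1_eq])
      measurable
  have int_f: "(LINT x:A|lebesgue. f x) = (LINT x|lborel. h x)"
  proof -
    have "(LINT x:A|lebesgue. f x) = (LINT x|lebesgue. h x)"
      unfolding set_lebesgue_integral_def by (rule integral_cong_AE[OF _ h_leb f1_eq]) measurable
    then show ?thesis by (simp add: integral_completion)
  qed
  have int_f2: "(LINT x:A|lebesgue. (f x)\<^sup>2) = (LINT x|lborel. (h x)\<^sup>2)"
  proof -
    have "(LINT x:A|lebesgue. (f x)\<^sup>2) = (LINT x|lebesgue. (h x)\<^sup>2)"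
      unfolding set_lebesgue_integral_def by (rule integral_cong_AE[OF _ h2_leb f2_eq]) measurable
    then show ?thesis by (simp add: integral_completion)
  qed
  have int_a: "(LINT x|lborel. a x) = measure lborel A"
    unfolding a_def[abs_def] by simp
  let ?T = "\<lambda>p. (h (fst p))\<^sup>2 * a (snd p) + a (fst p) * (h (snd p))\<^sup>2 - 2 * (h (fst p) * h (snd p))"
  have T_int: "integrable lborel ?T"
    by (intro Bochner_Integration.integrable_diff Bochner_Integration.integrable_add
        integrable_mult_right integrable_tensor h h2 a)
  have T_val: "(LINT p|lborel. ?T p)
      = 2 * measure lborel A * (LINT x|lborel. (h x)\<^sup>2) - 2 * (LINT x|lborel. h x)\<^sup>2"
    using integrable_tensor[OF h2 a] integrable_tensor[OF a h2] integrable_tensor[OF h h]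
    by (simp add: int_a power2_eq_square)
  let ?S = "\<lambda>p. indicator (A \<times> A) p * (f (fst p) - f (snd p))\<^sup>2"
  have S_meas: "?S \<in> borel_measurable lebesgue"
  proof -
    have "A \<times> A \<in> sets (lebesgue :: ('a \<times> 'a) measure)"
      using A(1) by (intro sets_completionI_sets) (simp add: borel_prod[symmetric])
    then show ?thesis
      using borel_measurable_lebesgue_fst[OF f] borel_measurable_lebesgue_snd[OF f]
      by (intro borel_measurable_times borel_measurable_power borel_measurable_diff
          borel_measurable_indicator)
  qed
  have ST: "AE p in lebesgue. ?S p = ?T p"
    using AE_completion[OF AE_lborel_fst[OF fg]] AE_completion[OF AE_lborel_snd[OF fg]]
    by eventually_elim (auto simp: h_def a_def indicator_def power2_eq_square algebra_simps)
  have T_meas: "?T \<in> borel_measurable lborel"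
    by (rule borel_measurable_integrable[OF T_int])
  then have T_leb: "?T \<in> borel_measurable lebesgue" by (rule measurable_completion)
  have "integrable lebesgue ?T"
    using T_int by (subst integrable_completion[OF T_meas])
  then show "integrable lebesgue ?S"
    by (rule Bochner_Integration.integrable_cong_AE[THEN iffD2, rotated -1, OF _ S_meas T_leb ST])
  show "(LINT p|lebesgue. ?S p)
      = 2 * measure lborel A * (LINT x:A|lebesgue. (f x)\<^sup>2) - 2 * (LINT x:A|lebesgue. f x)\<^sup>2"
    using integral_cong_AE[OF S_meas T_leb ST] integral_completion[OF T_meas] T_val
    by (simp add: int_f int_f2)
qed

lemma integral_square_le:
  fixes f :: "'a::euclidean_space \<Rightarrow> real"
  assumes "f \<in> borel_measurable lebesgue" "A \<in> sets borel" "emeasure lborel A < \<infinity>"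
    "set_integrable lebesgue A (\<lambda>x. (f x)\<^sup>2)"
  shows "(LINT x:A|lebesgue. f x)\<^sup>2 \<le> measure lborel A * (LINT x:A|lebesgue. (f x)\<^sup>2)"
proof -
  have "0 \<le> (LINT p|lebesgue. indicator (A \<times> A) p * (f (fst p) - f (snd p))\<^sup>2)"
    by (rule integral_nonneg_AE) simp
  then show ?thesis using integral_square_differences(3)[OF assms] by simp
qed

context kernel_problem begin

lemma X\<^sub>0_measurable: "u \<in> X\<^sub>0 \<Longrightarrow> u \<in> borel_measurable lebesgue"
  by (simp add: X\<^sub>0_iff)

lemma X\<^sub>0_outside: "u \<in> X\<^sub>0 \<Longrightarrow> AE x in lebesgue. x \<notin> \<Omega> \<longrightarrow> u x = 0"
  by (simp add: X\<^sub>0_iff)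

text \<open>Elements of \<open>X\<^sub>0\<close> vanish almost everywhere outside \<open>\<Omega>\<close>, and their weighted differences almost
everywhere outside \<open>Q\<close>. Both forms are therefore integrals over the whole space, where Fubini and
subsets that are not contained in \<open>\<Omega>\<close> can be used freely.\<close>

lemma X\<^sub>0_full_L2:
  assumes u: "u \<in> X\<^sub>0"
  shows "integrable lebesgue (\<lambda>x. (u x)\<^sup>2)"
    and "(LINT x|lebesgue. (u x)\<^sup>2) = L2_form u u"
proof -
  note [measurable] = X\<^sub>0_measurable[OF u] \<Omega>_measurable
  have eq: "AE x in lebesgue. indicator \<Omega> x *\<^sub>R (u x * u x) = (u x)\<^sup>2"
    using X\<^sub>0_outside[OF u] by eventually_elim (auto simp: indicator_def power2_eq_square)
  have int: "integrable lebesgue (\<lambda>x. indicator \<Omega> x *\<^sub>R (u x * u x))"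
    using L2_integrable[OF u u] by (simp add: set_integrable_def)
  show "integrable lebesgue (\<lambda>x. (u x)\<^sup>2)"
    by (rule Bochner_Integration.integrable_cong_AE[THEN iffD1, rotated -1, OF int _ _ eq]) measurable
  show "(LINT x|lebesgue. (u x)\<^sup>2) = L2_form u u"
    unfolding L2_form_def set_lebesgue_integral_def
    by (rule integral_cong_AE[symmetric, OF _ _ eq]) measurable
qed

lemma weighted_diff_outside:
  assumes u: "u \<in> X\<^sub>0"
  shows "AE p in lebesgue. p \<notin> Q \<longrightarrow> weighted_diff u p = 0"
proof -
  have *: "AE x in lborel. x \<notin> \<Omega> \<longrightarrow> u x = 0"
    using X\<^sub>0_outside[OF u] by (simp add: AE_completion_iff)
  show ?thesis
    using AE_completion[OF AE_lborel_fst[OF *]] AE_completion[OF AE_lborel_snd[OF *]]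
    by eventually_elim (auto simp: Q_set_def weighted_diff_def)
qed

lemma X\<^sub>0_full_energy:
  assumes u: "u \<in> X\<^sub>0"
  shows "integrable lebesgue (\<lambda>p. (weighted_diff u p)\<^sup>2)"
    and "(LINT p|lebesgue. (weighted_diff u p)\<^sup>2) = energy_form u u"
proof -
  note [measurable] = weighted_diff_measurable[OF X\<^sub>0_measurable[OF u]] Q_measurable
  have eq: "AE p in lebesgue. indicator Q p *\<^sub>R (weighted_diff u p * weighted_diff u p) = (weighted_diff u p)\<^sup>2"
    using weighted_diff_outside[OF u] by eventually_elim (auto simp: indicator_def power2_eq_square)
  have int: "integrable lebesgue (\<lambda>p. indicator Q p *\<^sub>R (weighted_diff u p * weighted_diff u p))"
    using energy_integrable[OF u u] by (simp add: set_integrable_def)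
  show "integrable lebesgue (\<lambda>p. (weighted_diff u p)\<^sup>2)"
    by (rule Bochner_Integration.integrable_cong_AE[THEN iffD1, rotated -1, OF int _ _ eq]) measurable
  show "(LINT p|lebesgue. (weighted_diff u p)\<^sup>2) = energy_form u u"
    unfolding energy_form_eq set_lebesgue_integral_def
    by (rule integral_cong_AE[symmetric, OF _ _ eq]) measurable
qed

lemma X\<^sub>0_local:
  assumes u: "u \<in> X\<^sub>0" and A: "A \<in> sets borel" "emeasure lborel A < \<infinity>"
  shows "set_integrable lebesgue A (\<lambda>x. (u x)\<^sup>2)"
    and "set_integrable lebesgue A u"
    and "(LINT x:A|lebesgue. u x)\<^sup>2 \<le> measure lborel A * L2_form u u"
proof -
  have A': "A \<in> sets lebesgue" using A(1) by (intro sets_completionI_sets) simp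
  show 2: "set_integrable lebesgue A (\<lambda>x. (u x)\<^sup>2)"
    unfolding set_integrable_def
    by (rule integrable_mult_indicator[OF A' X\<^sub>0_full_L2(1)[OF u]])
  show "set_integrable lebesgue A u"
    by (rule integral_square_differences(1)[OF X\<^sub>0_measurable[OF u] A 2])
  have "(LINT x:A|lebesgue. (u x)\<^sup>2) \<le> (LINT x|lebesgue. (u x)\<^sup>2)"
    unfolding set_lebesgue_integral_def
    by (rule integral_mono[OF 2[unfolded set_integrable_def] X\<^sub>0_full_L2(1)[OF u]])
      (simp add: indicator_def)
  then show "(LINT x:A|lebesgue. u x)\<^sup>2 \<le> measure lborel A * L2_form u u"
    using integral_square_le[OF X\<^sub>0_measurable[OF u] A 2]
    by (simp add: X\<^sub>0_full_L2(2)[OF u] order_trans[OF _ mult_left_mono])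
qed

text \<open>The power that bounds \<open>K\<close> from below is decreasing, so on a block \<open>A \<times> A\<close> with \<open>A\<close> of diameter
at most \<open>d\<close> the kernel is at least the value of that power at \<open>d\<close>, and the remaining integral of squared differences is known from the variance identity.
Disjoint sets give disjoint blocks, so the contributions add up to at most the energy.\<close>

lemma block_coercivity:
  assumes u: "u \<in> X\<^sub>0"
    and c: "c > 0" "\<And>x. x \<noteq> 0 \<Longrightarrow> K x \<ge> c * norm x powr (- (real CARD('n) + 2 * s))"
    and fin: "finite \<A>" and disj: "disjoint \<A>"
    and A: "\<And>A. A \<in> \<A> \<Longrightarrow> A \<in> sets borel" "\<And>A. A \<in> \<A> \<Longrightarrow> emeasure lborel A < \<infinity>"
    and d: "d > 0" "\<And>A x y. A \<in> \<A> \<Longrightarrow> x \<in> A \<Longrightarrow> y \<in> A \<Longrightarrow> norm (x - y) \<le> d"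
  shows "c * d powr (- (real CARD('n) + 2 * s)) *
      (\<Sum>A\<in>\<A>. 2 * measure lborel A * (LINT x:A|lebesgue. (u x)\<^sup>2) - 2 * (LINT x:A|lebesgue. u x)\<^sup>2)
    \<le> energy_form u u"
proof -
  define C where "C = c * d powr (- (real CARD('n) + 2 * s))"
  let ?S = "\<lambda>A p. indicator (A \<times> A) p * (u (fst p) - u (snd p))\<^sup>2"
  note S = integral_square_differences(2,3)[OF X\<^sub>0_measurable[OF u] A X\<^sub>0_local(1)[OF u A]]
  have int: "integrable lebesgue (\<lambda>p. C * (\<Sum>A\<in>\<A>. ?S A p))"
    using S(1) by (intro integrable_mult_right Bochner_Integration.integrable_sum)
  have le: "C * (\<Sum>A\<in>\<A>. ?S A p) \<le> (weighted_diff u p)\<^sup>2" for p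
  proof (cases "\<exists>A\<in>\<A>. p \<in> A \<times> A")
    case True
    then obtain A where A: "A \<in> \<A>" "p \<in> A \<times> A" by blast
    have zero: "?S B p = 0" if "B \<in> \<A> - {A}" for B
      using disjointD[OF disj A(1), of B] that A by (auto simp: indicator_def)
    have "(\<Sum>B\<in>\<A>. ?S B p) = ?S A p + (\<Sum>B\<in>\<A> - {A}. ?S B p)"
      using fin A(1) by (rule sum.remove)
    also have "(\<Sum>B\<in>\<A> - {A}. ?S B p) = 0" using zero by (intro sum.neutral) blast
    finally have eq: "(\<Sum>B\<in>\<A>. ?S B p) = (u (fst p) - u (snd p))\<^sup>2" using A(2) by simp
    show ?thesis
    proof (cases "fst p = snd p")
      case False
      let ?z = "fst p - snd p"
      have "C \<le> c * norm ?z powr (- (real CARD('n) + 2 * s))"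
        unfolding C_def using d(2)[OF A(1)] A(2) False c(1) s_pos
        by (intro mult_left_mono powr_mono2') auto
      also have "\<dots> \<le> K ?z" using c(2) False by simp
      finally have "C * (u (fst p) - u (snd p))\<^sup>2 \<le> K ?z * (u (fst p) - u (snd p))\<^sup>2"
        by (rule mult_right_mono) simp
      also have "\<dots> = (weighted_diff u p)\<^sup>2"
        unfolding power2_eq_square[of "weighted_diff u p"] weighted_diff_mult
        by (simp add: case_prod_unfold power2_eq_square mult_ac)
      finally show ?thesis by (simp only: eq)
    qed (simp add: eq)
  next
    case False
    then have "(\<Sum>A\<in>\<A>. ?S A p) = 0" by (intro sum.neutral) (auto simp: indicator_def)
    then show ?thesis by simp
  qed
  have "(LINT p|lebesgue. C * (\<Sum>A\<in>\<A>. ?S A p)) \<le> (LINT p|lebesgue. (weighted_diff u p)\<^sup>2)"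
    by (rule integral_mono[OF int X\<^sub>0_full_energy(1)[OF u] le])
  also have "(LINT p|lebesgue. C * (\<Sum>A\<in>\<A>. ?S A p)) = C * (\<Sum>A\<in>\<A>. LINT p|lebesgue. ?S A p)"
    using S(1) by (subst integral_mult_right_zero, subst Bochner_Integration.integral_sum) auto
  also have "(\<Sum>A\<in>\<A>. LINT p|lebesgue. ?S A p) =
      (\<Sum>A\<in>\<A>. 2 * measure lborel A * (LINT x:A|lebesgue. (u x)\<^sup>2) - 2 * (LINT x:A|lebesgue. u x)\<^sup>2)"
    using S(2) by (intro sum.cong) auto
  finally show ?thesis by (simp only: X\<^sub>0_full_energy(2)[OF u] C_def)
qed

end

section \<open>Poincare inequality and spectral gap\<close>

text \<open>The cells of the grid of mesh \<open>h\<close>, as level sets of \<open>x \<mapsto> (\<lfloor>x $ i / h\<rfloor>)\<^sub>i\<close>.\<close>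

lemma cube_partition:
  fixes S :: "(real ^ 'n) set"
  assumes S: "bounded S" and h: "h > 0"
  obtains \<A> where "finite \<A>" "disjoint \<A>" "S \<subseteq> \<Union>\<A>"
    "\<forall>A\<in>\<A>. A \<in> sets borel \<and> emeasure lborel A < \<infinity> \<and> h ^ CARD('n) \<le> measure lborel A"
    "\<forall>A\<in>\<A>. \<forall>x\<in>A. \<forall>y\<in>A. norm (x - y) \<le> real CARD('n) * h"
proof -
  define key :: "real ^ 'n \<Rightarrow> 'n \<Rightarrow> int" where "key x i = \<lfloor>x $ i / h\<rfloor>" for x i
  define cell where "cell \<kappa> = {x. key x = \<kappa>}" for \<kappa>
  obtain R where R: "\<And>x. x \<in> S \<Longrightarrow> norm x \<le> R"
    using S by (auto simp: bounded_iff)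
  have key_range: "key x i \<in> {\<lfloor>- R / h\<rfloor>..\<lfloor>R / h\<rfloor>}" if "x \<in> S" for x i
  proof -
    have "\<bar>x $ i\<bar> \<le> R" using component_le_norm_cart[of x i] R[OF that] by simp
    then have "- R \<le> x $ i" "x $ i \<le> R" by auto
    then have "- R / h \<le> x $ i / h" "x $ i / h \<le> R / h"
      using h by (auto intro: divide_right_mono simp del: divide_minus_left)
    then show ?thesis by (auto simp: key_def intro: floor_mono)
  qed
  have coord: "h * key x i \<le> x $ i \<and> x $ i < h * (key x i + 1)" for x i
  proof -
    have "real_of_int (key x i) \<le> x $ i / h" "x $ i / h < real_of_int (key x i) + 1"
      by (auto simp: key_def)
    then show ?thesis using h by (auto simp: field_simps)
  qed
  have diam: "norm (x - y) \<le> real CARD('n) * h" if "x \<in> cell \<kappa>" "y \<in> cell \<kappa>" for \<kappa> x y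
  proof -
    have "\<bar>(x - y) $ i\<bar> \<le> h" for i
      using coord[of x i] coord[of y i] that by (auto simp: cell_def algebra_simps)
    then have "(\<Sum>i\<in>UNIV. \<bar>(x - y) $ i\<bar>) \<le> (\<Sum>i\<in>(UNIV :: 'n set). h)"
      by (rule sum_mono)
    then show ?thesis using norm_le_l1_cart[of "x - y"] by simp
  qed
  have borel: "cell \<kappa> \<in> sets borel" for \<kappa>
  proof -
    have "cell \<kappa> = (\<Inter>i. {x. key x i = \<kappa> i})"
      by (auto simp: cell_def)
    moreover have "{x. key x i = \<kappa> i} \<in> sets borel" for i
      unfolding key_def by measurable
    ultimately show ?thesis by auto
  qed
  have finite_measure: "emeasure lborel (cell \<kappa>) < \<infinity>" for \<kappa>
  proof (cases "cell \<kappa> = {}")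
    case False
    then obtain y where "y \<in> cell \<kappa>" by blast
    then have "cell \<kappa> \<subseteq> cball y (real CARD('n) * h)"
      using diam by (auto simp: dist_norm)
    then have "bounded (cell \<kappa>)" using bounded_cball bounded_subset by blast
    then show ?thesis by (rule emeasure_bounded_finite)
  qed simp
  have volume: "h ^ CARD('n) \<le> measure lborel (cell \<kappa>)" for \<kappa>
  proof -
    let ?a = "(\<chi> i. h * \<kappa> i) :: real ^ 'n" and ?b = "(\<chi> i. h * (\<kappa> i + 1)) :: real ^ 'n"
    have sub: "box ?a ?b \<subseteq> cell \<kappa>"
    proof
      fix x assume x: "x \<in> box ?a ?b"
      have "key x i = \<kappa> i" for i
      proof -
        have "h * \<kappa> i < x $ i" "x $ i < h * (\<kappa> i + 1)"
          using x by (auto simp: mem_box_cart)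
        then have "real_of_int (\<kappa> i) \<le> x $ i / h" "x $ i / h < real_of_int (\<kappa> i) + 1"
          using h by (auto simp: field_simps)
        then show ?thesis unfolding key_def by (simp add: floor_unique)
      qed
      then show "x \<in> cell \<kappa>" by (auto simp: cell_def)
    qed
    have "cbox ?a ?b \<noteq> {}"
      using h by (auto simp: interval_ne_empty_cart)
    then have "measure lborel (cbox ?a ?b) = h ^ CARD('n)"
      by (simp add: content_cbox_cart algebra_simps)
    moreover have "measure lborel (box ?a ?b) = measure lborel (cbox ?a ?b)"
      by (simp add: measure_lborel_box_eq measure_lborel_cbox_eq)
    moreover have "measure lborel (box ?a ?b) \<le> measure lborel (cell \<kappa>)"
      using finite_measure borel by (intro measure_mono_fmeasurable sub fmeasurableI) auto
    ultimately show ?thesis by simp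
  qed
  define \<A> where "\<A> = cell ` key ` S"
  have "key ` S \<subseteq> Pi\<^sub>E UNIV (\<lambda>_. {\<lfloor>- R / h\<rfloor>..\<lfloor>R / h\<rfloor>})"
    using key_range by (auto simp: PiE_def)
  then have "finite (key ` S)"
    by (rule finite_subset) (rule finite_PiE, simp_all)
  then have "finite \<A>" by (simp add: \<A>_def)
  moreover have "disjoint \<A>"
    by (auto simp: \<A>_def disjoint_def cell_def)
  moreover have "S \<subseteq> \<Union>\<A>"
    by (auto simp: \<A>_def cell_def)
  ultimately show thesis
    using borel finite_measure volume diam by (intro that[of \<A>]) (auto simp: \<A>_def)
qed

context kernel_problem begin

lemma \<Omega>_finite_measure: "\<Omega> \<in> sets borel" "emeasure lborel \<Omega> < \<infinity>"
  using \<Omega>_open emeasure_bounded_finite[OF \<Omega>_bounded] by auto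

lemma X\<^sub>0_integral_superset:
  assumes u: "u \<in> X\<^sub>0" and A: "A \<in> sets borel" "\<Omega> \<subseteq> A"
  shows "(LINT x:A|lebesgue. (u x)\<^sup>2) = L2_form u u"
    and "(LINT x:A|lebesgue. u x) = (LINT x:\<Omega>|lebesgue. u x)"
proof -
  have A': "A \<in> sets lebesgue" using A(1) by (intro sets_completionI_sets) simp
  note [measurable] = X\<^sub>0_measurable[OF u] \<Omega>_measurable A'
  show "(LINT x:A|lebesgue. (u x)\<^sup>2) = L2_form u u"
    unfolding L2_form_def set_lebesgue_integral_def
  proof (rule integral_cong_AE)
    show "AE x in lebesgue. indicator A x *\<^sub>R (u x)\<^sup>2 = indicator \<Omega> x *\<^sub>R (u x * u x)"
      using X\<^sub>0_outside[OF u] by eventually_elim (use A(2) in \<open>auto simp: indicator_def power2_eq_square\<close>)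
  qed measurable
  show "(LINT x:A|lebesgue. u x) = (LINT x:\<Omega>|lebesgue. u x)"
    unfolding set_lebesgue_integral_def
  proof (rule integral_cong_AE)
    show "AE x in lebesgue. indicator A x *\<^sub>R u x = indicator \<Omega> x *\<^sub>R u x"
      using X\<^sub>0_outside[OF u] by eventually_elim (use A(2) in \<open>auto simp: indicator_def\<close>)
  qed measurable
qed

text \<open>Block coercivity with one cube \<open>A \<supseteq> \<Omega>\<close>. By Cauchy--Schwarz on \<open>\<Omega>\<close> the square of the integral of \<open>u\<close>
costs at most \<open>|\<Omega>| \<integral> u\<^sup>2\<close>, less than the gain \<open>|A| \<integral> u\<^sup>2\<close> as soon as \<open>|A| > |\<Omega>|\<close>.\<close>

lemma poincare: "\<exists>C>0. \<forall>u\<in>X\<^sub>0. C * L2_form u u \<le> energy_form u u"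
proof -
  obtain c where c: "c > 0" "\<And>x. x \<noteq> 0 \<Longrightarrow> K x \<ge> c * norm x powr (- (real CARD('n) + 2 * s))"
    using K_lower by blast
  obtain r where r: "\<And>x. x \<in> \<Omega> \<Longrightarrow> norm x \<le> r"
    using \<Omega>_bounded by (auto simp: bounded_iff)
  \<comment> \<open>Large enough for the cube of side \<open>2 * R\<close> to contain \<open>\<Omega>\<close> and to have larger volume.\<close>
  define R where "R = max 1 (max r (measure lborel \<Omega>))"
  define A :: "(real ^ 'n) set" where "A = cbox (\<chi> i. - R) (\<chi> i. R)"
  have R: "R \<ge> 1" "R \<ge> r" "R \<ge> measure lborel \<Omega>" by (auto simp: R_def)
  have "x \<in> A" if "x \<in> \<Omega>" for x
  proof -
    have "\<bar>x $ i\<bar> \<le> R" for i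
      using component_le_norm_cart[of x i] r[OF that] R(2) by linarith
    then have "- R \<le> x $ i" "x $ i \<le> R" for i by (simp_all add: abs_le_iff minus_le_iff)
    then show ?thesis by (simp add: A_def mem_box_cart)
  qed
  then have sub: "\<Omega> \<subseteq> A" by blast
  have "measure lborel A = (2 * R) ^ CARD('n)"
  proof -
    have "A \<noteq> {}" using sub \<Omega>_nonempty by blast
    then show ?thesis by (simp add: A_def content_cbox_cart)
  qed
  also have "\<dots> \<ge> 2 * R"
    using R(1) by (intro self_le_power) auto
  finally have vol: "measure lborel A > measure lborel \<Omega>" using R by simp
  have "bounded A" by (simp add: A_def bounded_cbox)
  have A: "A \<in> sets borel" "emeasure lborel A < \<infinity>"
    using emeasure_bounded_finite[OF \<open>bounded A\<close>] by (simp_all add: A_def)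
  have diam: "norm (x - y) \<le> diameter A + 1" if "x \<in> A" "y \<in> A" for x y
    using diameter_bounded_bound[OF \<open>bounded A\<close> that] by (simp add: dist_norm)
  have d: "diameter A + 1 > 0" using diameter_ge_0[OF \<open>bounded A\<close>] by simp
  define C where "C = c * (diameter A + 1) powr (- (real CARD('n) + 2 * s))"
  have C: "C > 0" using c(1) d by (simp add: C_def)
  have "C * (2 * (measure lborel A - measure lborel \<Omega>)) * L2_form u u \<le> energy_form u u"
    if u: "u \<in> X\<^sub>0" for u
  proof -
    have "C * (2 * measure lborel A * L2_form u u - 2 * (LINT x:\<Omega>|lebesgue. u x)\<^sup>2) \<le> energy_form u u"
      using block_coercivity[OF u c, of "{A}" "diameter A + 1"] A d diam
      by (simp add: X\<^sub>0_integral_superset[OF u A(1) sub] C_def)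
    moreover have "C * (2 * (measure lborel A - measure lborel \<Omega>)) * L2_form u u
        \<le> C * (2 * measure lborel A * L2_form u u - 2 * (LINT x:\<Omega>|lebesgue. u x)\<^sup>2)"
      using X\<^sub>0_local(3)[OF u \<Omega>_finite_measure] C
      unfolding mult.assoc by (intro mult_left_mono) (simp_all add: algebra_simps)
    ultimately show ?thesis by linarith
  qed
  moreover have "C * (2 * (measure lborel A - measure lborel \<Omega>)) > 0"
    using C vol by simp
  ultimately show ?thesis by blast
qed

text \<open>Block coercivity on cubes of side \<open>h\<close>: the coefficient of \<open>\<integral> u\<^sup>2\<close> is a constant multiple of
\<open>h\<^sup>n h\<^sup>-\<^sup>n\<^sup>-\<^sup>2\<^sup>s = h\<^sup>-\<^sup>2\<^sup>s\<close>, which exceeds any \<open>\<Lambda>\<close> for small \<open>h\<close>. The functionals are the integrals over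
the finitely many cubes that meet \<open>\<Omega>\<close>.\<close>

lemma spectral_gap:
  "\<exists>(f :: nat \<Rightarrow> (real ^ 'n \<Rightarrow> real) \<Rightarrow> real) m C.
    (\<forall>i<m. (\<forall>u\<in>X\<^sub>0. \<forall>v\<in>X\<^sub>0. f i (\<lambda>x. u x - v x) = f i u - f i v) \<and>
            (\<exists>D. \<forall>v\<in>X\<^sub>0. (f i v)\<^sup>2 \<le> D * L2_form v v)) \<and>
    (\<forall>v\<in>X\<^sub>0. \<Lambda> * L2_form v v \<le> energy_form v v + C * (\<Sum>i<m. (f i v)\<^sup>2))"
proof -
  obtain c where c: "c > 0" "\<And>x. x \<noteq> 0 \<Longrightarrow> K x \<ge> c * norm x powr (- (real CARD('n) + 2 * s))"
    using K_lower by blast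
  define N where "N = real CARD('n)"
  have N: "N > 0" by (simp add: N_def)
  \<comment> \<open>\<open>h\<close> is chosen with \<open>h powr (- 2 s) = T\<close>, where \<open>T\<close> is the size that the level \<open>\<Lambda>\<close> requires.\<close>
  define T where "T = \<bar>\<Lambda>\<bar> / (2 * c * N powr (- (N + 2 * s))) + 1"
  have "2 * c * N powr (- (N + 2 * s)) > 0" using c(1) N by simp
  then have T: "T > 0" and T_large: "\<Lambda> \<le> 2 * c * N powr (- (N + 2 * s)) * T"
    by (auto simp: T_def field_simps add_pos_nonneg intro: order_trans[OF abs_ge_self])
  define h where "h = T powr (- 1 / (2 * s))"
  have h: "h > 0" using T by (simp add: h_def)
  have hT: "h powr (- (2 * s)) = T"
    using T s_pos by (simp add: h_def powr_powr)
  define C where "C = c * (N * h) powr (- (N + 2 * s))"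
  have C: "C > 0" using c(1) N h by (simp add: C_def)
  have "2 * C * h ^ CARD('n) = 2 * c * N powr (- (N + 2 * s)) * (h powr (- (N + 2 * s)) * h powr N)"
    using N h by (simp add: C_def powr_mult N_def powr_realpow)
  also have "h powr (- (N + 2 * s)) * h powr N = T"
    unfolding powr_add[symmetric] hT[symmetric] by simp
  finally have large: "\<Lambda> \<le> 2 * C * h ^ CARD('n)" using T_large by simp
  obtain \<A> where \<A>: "finite \<A>" "disjoint \<A>" "\<Omega> \<subseteq> \<Union>\<A>"
    and cells: "\<forall>A\<in>\<A>. A \<in> sets borel \<and> emeasure lborel A < \<infinity> \<and> h ^ CARD('n) \<le> measure lborel A"
    and diam: "\<forall>A\<in>\<A>. \<forall>x\<in>A. \<forall>y\<in>A. norm (x - y) \<le> real CARD('n) * h"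
    by (rule cube_partition[OF \<Omega>_bounded h])
  have A: "A \<in> sets borel" "emeasure lborel A < \<infinity>" "h ^ CARD('n) \<le> measure lborel A"
    if "A \<in> \<A>" for A using cells that by auto
  obtain e where e: "bij_betw e {..<card \<A>} \<A>"
    using ex_bij_betw_nat_finite[OF \<A>(1)] by (auto simp: lessThan_atLeast0)
  define f where "f i u = (LINT x:e i|lebesgue. u x)" for i and u :: "real ^ 'n \<Rightarrow> real"
  have e_in: "e i \<in> \<A>" if "i < card \<A>" for i
    using bij_betwE[OF e] that by simp
  have "f i (\<lambda>x. u x - v x) = f i u - f i v" if "i < card \<A>" "u \<in> X\<^sub>0" "v \<in> X\<^sub>0" for i u v
    unfolding f_def using X\<^sub>0_local(2)[OF _ A(1,2)[OF e_in[OF that(1)]]] that(2,3)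
    by (intro set_integral_diff) auto
  moreover have "(f i v)\<^sup>2 \<le> measure lborel (e i) * L2_form v v" if "i < card \<A>" "v \<in> X\<^sub>0" for i v
    unfolding f_def by (rule X\<^sub>0_local(3)[OF that(2) A(1,2)[OF e_in[OF that(1)]]])
  moreover have "\<Lambda> * L2_form v v \<le> energy_form v v + 2 * C * (\<Sum>i<card \<A>. (f i v)\<^sup>2)"
    if v: "v \<in> X\<^sub>0" for v
  proof -
    have A': "A \<in> sets lebesgue" if "A \<in> \<A>" for A using A(1)[OF that] by (intro sets_completionI_sets) simp
    note [measurable] = X\<^sub>0_measurable[OF v]
    have int: "integrable lebesgue (\<lambda>x. indicator A x *\<^sub>R (v x)\<^sup>2)" if "A \<in> \<A>" for A
      using X\<^sub>0_local(1)[OF v A(1,2)[OF that]] by (simp add: set_integrable_def)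
    have one: "(\<Sum>A\<in>\<A>. indicator A x * (v x)\<^sup>2) = (v x)\<^sup>2" if x: "x \<in> \<Omega>" for x
    proof -
      obtain A where A: "A \<in> \<A>" "x \<in> A" using \<A>(3) x by blast
      have "(\<Sum>B\<in>\<A>. indicator B x * (v x)\<^sup>2)
          = indicator A x * (v x)\<^sup>2 + (\<Sum>B\<in>\<A> - {A}. indicator B x * (v x)\<^sup>2)"
        by (rule sum.remove[OF \<A>(1) A(1)])
      also have "(\<Sum>B\<in>\<A> - {A}. indicator B x * (v x)\<^sup>2) = 0"
        using disjointD[OF \<A>(2) A(1)] A(2) by (intro sum.neutral) (auto simp: indicator_def)
      finally show ?thesis using A(2) by simp
    qed
    have "(\<Sum>A\<in>\<A>. LINT x:A|lebesgue. (v x)\<^sup>2) = (LINT x|lebesgue. (\<Sum>A\<in>\<A>. indicator A x *\<^sub>R (v x)\<^sup>2))"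
      unfolding set_lebesgue_integral_def
      by (rule Bochner_Integration.integral_sum[symmetric]) (rule int)
    also have "\<dots> = (LINT x|lebesgue. (v x)\<^sup>2)"
    proof (rule integral_cong_AE)
      show "AE x in lebesgue. (\<Sum>A\<in>\<A>. indicator A x *\<^sub>R (v x)\<^sup>2) = (v x)\<^sup>2"
        using X\<^sub>0_outside[OF v]
      proof eventually_elim
        case (elim x)
        show ?case using one[of x] elim by (cases "x \<in> \<Omega>") simp_all
      qed
      show "(\<lambda>x. \<Sum>A\<in>\<A>. indicator A x *\<^sub>R (v x)\<^sup>2) \<in> borel_measurable lebesgue"
        by (rule borel_measurable_sum) (rule borel_measurable_integrable[OF int])
    qed measurable
    finally have total: "(\<Sum>A\<in>\<A>. LINT x:A|lebesgue. (v x)\<^sup>2) = L2_form v v"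
      by (simp only: X\<^sub>0_full_L2(2)[OF v])
    have nonneg: "0 \<le> (LINT x:A|lebesgue. (v x)\<^sup>2)" for A
      unfolding set_lebesgue_integral_def by (rule integral_nonneg_AE) simp
    have "2 * C * h ^ CARD('n) * L2_form v v - 2 * C * (\<Sum>A\<in>\<A>. (LINT x:A|lebesgue. v x)\<^sup>2)
        = C * (\<Sum>A\<in>\<A>. 2 * h ^ CARD('n) * (LINT x:A|lebesgue. (v x)\<^sup>2) - 2 * (LINT x:A|lebesgue. v x)\<^sup>2)"
      unfolding total[symmetric] by (simp add: sum_subtractf sum_distrib_left right_diff_distrib mult_ac)
    also have "\<dots> \<le> C * (\<Sum>A\<in>\<A>. 2 * measure lborel A * (LINT x:A|lebesgue. (v x)\<^sup>2)
        - 2 * (LINT x:A|lebesgue. v x)\<^sup>2)"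
      using C A(3) nonneg by (intro mult_left_mono sum_mono diff_right_mono mult_right_mono) auto
    also have "\<dots> \<le> energy_form v v"
      using block_coercivity[OF v c \<A>(1,2) A(1,2), of "N * h"] diam N h
      by (simp add: C_def N_def)
    finally have "2 * C * h ^ CARD('n) * L2_form v v
        \<le> energy_form v v + 2 * C * (\<Sum>A\<in>\<A>. (LINT x:A|lebesgue. v x)\<^sup>2)" by simp
    moreover have "(\<Sum>A\<in>\<A>. (LINT x:A|lebesgue. v x)\<^sup>2) = (\<Sum>i<card \<A>. (f i v)\<^sup>2)"
      unfolding f_def by (rule sum.reindex_bij_betw[OF e, symmetric])
    moreover have "\<Lambda> * L2_form v v \<le> 2 * C * h ^ CARD('n) * L2_form v v"
      using large L.B_nonneg[OF v] by (rule mult_right_mono)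
    ultimately show ?thesis by simp
  qed
  ultimately show ?thesis
    by (intro exI[of _ f] exI[of _ "card \<A>"] exI[of _ "2 * C"]) blast
qed

end

section \<open>Closedness of the energy form\<close>

lemma fatou_square_integral:
  fixes f :: "nat \<Rightarrow> 'a \<Rightarrow> real" and g :: "'a \<Rightarrow> real"
  assumes f: "\<And>k. integrable M (\<lambda>x. (f k x)\<^sup>2)" and g: "g \<in> borel_measurable M"
    and lim: "AE x in M. (\<lambda>k. f k x) \<longlonglongrightarrow> g x"
    and le: "\<forall>\<^sub>F k in sequentially. (LINT x|M. (f k x)\<^sup>2) \<le> c"
  shows "integrable M (\<lambda>x. (g x)\<^sup>2)" and "(LINT x|M. (g x)\<^sup>2) \<le> c"
proof -
  have c: "0 \<le> c"
  proof -
    obtain k where "(LINT x|M. (f k x)\<^sup>2) \<le> c"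
      using eventually_happens'[OF sequentially_bot le] by blast
    moreover have "0 \<le> (LINT x|M. (f k x)\<^sup>2)" by (rule integral_nonneg_AE) simp
    ultimately show ?thesis by linarith
  qed
  have "(\<integral>\<^sup>+x. ennreal ((g x)\<^sup>2) \<partial>M) = (\<integral>\<^sup>+x. liminf (\<lambda>k. ennreal ((f k x)\<^sup>2)) \<partial>M)"
  proof (rule nn_integral_cong_AE)
    show "AE x in M. ennreal ((g x)\<^sup>2) = liminf (\<lambda>k. ennreal ((f k x)\<^sup>2))"
      using lim
    proof eventually_elim
      case (elim x)
      have "(\<lambda>k. ennreal ((f k x)\<^sup>2)) \<longlonglongrightarrow> ennreal ((g x)\<^sup>2)"
        by (intro tendsto_ennrealI tendsto_power elim)
      then show ?case by (rule lim_imp_Liminf[symmetric, OF sequentially_bot])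
    qed
  qed
  also have "\<dots> \<le> liminf (\<lambda>k. \<integral>\<^sup>+x. ennreal ((f k x)\<^sup>2) \<partial>M)"
    using f by (intro nn_integral_liminf measurable_compose[OF _ measurable_ennreal]
        borel_measurable_integrable)
  also have "\<dots> = liminf (\<lambda>k. ennreal (LINT x|M. (f k x)\<^sup>2))"
    using f by (simp add: nn_integral_eq_integral)
  also have "\<dots> \<le> ennreal c"
  proof -
    have "liminf (\<lambda>k. ennreal (LINT x|M. (f k x)\<^sup>2)) \<le> liminf (\<lambda>k. ennreal c)"
      using le by (intro Liminf_mono) (auto elim!: eventually_mono intro: ennreal_leI)
    then show ?thesis by (simp add: Liminf_const)
  qed
  finally have bound: "(\<integral>\<^sup>+x. ennreal ((g x)\<^sup>2) \<partial>M) \<le> ennreal c" .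
  show "integrable M (\<lambda>x. (g x)\<^sup>2)"
    using g bound
    by (intro integrableI_bounded) (auto simp: le_less_trans[OF bound])
  show "(LINT x|M. (g x)\<^sup>2) \<le> c"
    by (rule integral_real_bounded[OF c bound])
qed

text \<open>The sum of the increments has finite integral, hence is finite almost everywhere, and then the
telescoping series converges.\<close>

lemma AE_convergent_of_summable_increments:
  fixes f :: "nat \<Rightarrow> 'a \<Rightarrow> real"
  assumes int: "\<And>k. integrable M (\<lambda>x. \<bar>f (Suc k) x - f k x\<bar>)"
    and sum: "summable (\<lambda>k. LINT x|M. \<bar>f (Suc k) x - f k x\<bar>)"
  shows "AE x in M. convergent (\<lambda>k. f k x)"
proof -
  let ?d = "\<lambda>k x. \<bar>f (Suc k) x - f k x\<bar>"
  have meas: "(\<lambda>x. ennreal (?d k x)) \<in> borel_measurable M" for k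
    by (rule measurable_compose[OF borel_measurable_integrable[OF int] measurable_ennreal])
  have "(\<integral>\<^sup>+x. (\<Sum>k. ennreal (?d k x)) \<partial>M) = (\<Sum>k. \<integral>\<^sup>+x. ennreal (?d k x) \<partial>M)"
    by (rule nn_integral_suminf[OF meas])
  also have "\<dots> = (\<Sum>k. ennreal (LINT x|M. ?d k x))"
    using int by (simp add: nn_integral_eq_integral)
  also have "\<dots> = ennreal (\<Sum>k. LINT x|M. ?d k x)"
    by (rule suminf_ennreal2[OF _ sum]) (rule integral_nonneg_AE, simp)
  finally have "(\<integral>\<^sup>+x. (\<Sum>k. ennreal (?d k x)) \<partial>M) \<noteq> \<infinity>" by simp
  then have "AE x in M. (\<Sum>k. ennreal (?d k x)) \<noteq> \<infinity>"
    by (intro nn_integral_noteq_infinite borel_measurable_suminf_order meas)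
  then show ?thesis
  proof eventually_elim
    case (elim x)
    then have "summable (\<lambda>k. ?d k x)" by (intro summable_suminf_not_top) auto
    then have "summable (\<lambda>k. f (Suc k) x - f k x)" by (rule summable_rabs_cancel)
    then have "convergent (\<lambda>n. \<Sum>k<n. f (Suc k) x - f k x)"
      by (simp add: summable_iff_convergent)
    then have "convergent (\<lambda>n. f n x - f 0 x)"
      by (simp only: sum_lessThan_telescope[of "\<lambda>n. f n x"])
    then show ?case
      using convergent_add[OF _ convergent_const[of "f 0 x"]] by fastforce
  qed
qed

context kernel_problem begin

lemma X\<^sub>0_L1_le:
  assumes u: "u \<in> X\<^sub>0"
  shows "integrable lebesgue (\<lambda>x. \<bar>indicator \<Omega> x * u x\<bar>)"
    and "(LINT x|lebesgue. \<bar>indicator \<Omega> x * u x\<bar>) \<le> sqrt (measure lborel \<Omega> * L2_form u u)"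
proof -
  have m: "(\<lambda>x. \<bar>u x\<bar>) \<in> borel_measurable lebesgue"
    using X\<^sub>0_measurable[OF u] by measurable
  have sq: "set_integrable lebesgue \<Omega> (\<lambda>x. \<bar>u x\<bar>\<^sup>2)"
    using L2_integrable[OF u u] by (simp add: power2_eq_square)
  have eq: "(\<lambda>x. \<bar>indicator \<Omega> x * u x\<bar>) = (\<lambda>x. indicator \<Omega> x *\<^sub>R \<bar>u x\<bar>)"
    by (auto simp: indicator_def)
  show "integrable lebesgue (\<lambda>x. \<bar>indicator \<Omega> x * u x\<bar>)"
    using integral_square_differences(1)[OF m \<Omega>_finite_measure sq]
    unfolding eq set_integrable_def .
  have "(LINT x:\<Omega>|lebesgue. \<bar>u x\<bar>)\<^sup>2 \<le> measure lborel \<Omega> * L2_form u u"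
    using integral_square_le[OF m \<Omega>_finite_measure sq] by (simp add: L2_form_def power2_eq_square)
  then show "(LINT x|lebesgue. \<bar>indicator \<Omega> x * u x\<bar>) \<le> sqrt (measure lborel \<Omega> * L2_form u u)"
    unfolding eq by (intro real_le_rsqrt) (simp add: set_lebesgue_integral_def)
qed

text \<open>Half of the Riesz--Fischer theorem: a subsequence with rapidly decreasing increments converges
almost everywhere. As \<open>\<Omega>\<close> has finite measure, the increments are small in \<open>L\<^sup>1\<close> as well.\<close>

lemma L2_Cauchy_AE_limit:
  fixes u :: "nat \<Rightarrow> real ^ 'n \<Rightarrow> real"
  assumes u: "\<And>n. u n \<in> X\<^sub>0"
    and cauchy: "\<And>e. e > 0 \<Longrightarrow>
      \<exists>N. \<forall>m\<ge>N. \<forall>n\<ge>N. L2_form (\<lambda>x. u m x - u n x) (\<lambda>x. u m x - u n x) < e"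
  obtains r v where "strict_mono r" "v \<in> borel_measurable lebesgue" "\<forall>x. x \<notin> \<Omega> \<longrightarrow> v x = 0"
    "AE x in lebesgue. (\<lambda>k. u (r k) x) \<longlonglongrightarrow> v x"
proof -
  have "\<forall>k. \<exists>N. \<forall>m\<ge>N. \<forall>n\<ge>N. L2_form (\<lambda>x. u m x - u n x) (\<lambda>x. u m x - u n x) < (1 / 4) ^ k"
    by (intro allI cauchy) simp
  then obtain N where N: "\<forall>k. \<forall>m\<ge>N k. \<forall>n\<ge>N k.
      L2_form (\<lambda>x. u m x - u n x) (\<lambda>x. u m x - u n x) < (1 / 4) ^ k"
    by (rule choice[THEN exE])
  \<comment> \<open>A strictly increasing sequence that stays above \<open>N\<close>.\<close>
  define r where "r k = (\<Sum>j\<le>k. Suc (N j))" for k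
  have r_mono: "strict_mono r" by (auto simp: strict_mono_Suc_iff r_def)
  have r_ge: "N k \<le> r k" for k
    using member_le_sum[of k "{..k}" "\<lambda>j. Suc (N j)"] by (simp add: r_def)
  define f where "f k x = indicator \<Omega> x * u (r k) x" for k x
  have f_diff: "\<bar>f (Suc k) x - f k x\<bar> = \<bar>indicator \<Omega> x * (u (r (Suc k)) x - u (r k) x)\<bar>" for k x
    by (simp add: f_def right_diff_distrib)
  have diff_in: "(\<lambda>x. u (r (Suc k)) x - u (r k) x) \<in> X\<^sub>0" for k
    using u by (intro E.V_diff)
  have increment: "(LINT x|lebesgue. \<bar>f (Suc k) x - f k x\<bar>) \<le> sqrt (measure lborel \<Omega>) * (1 / 2) ^ k" for k
  proof -
    let ?w = "\<lambda>x. u (r (Suc k)) x - u (r k) x"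
    have "N k \<le> r (Suc k)"
      using r_ge[of k] strict_monoD[OF r_mono, of k "Suc k"] by simp
    then have "L2_form ?w ?w \<le> (1 / 4) ^ k"
      using N r_ge[of k] by (intro less_imp_le) blast
    then have "sqrt (measure lborel \<Omega> * L2_form ?w ?w) \<le> sqrt (measure lborel \<Omega> * (1 / 4) ^ k)"
      by (intro real_sqrt_le_mono mult_left_mono) auto
    also have "\<dots> = sqrt (measure lborel \<Omega>) * (1 / 2) ^ k"
      by (simp add: real_sqrt_mult real_sqrt_power real_sqrt_divide)
    finally show ?thesis unfolding f_diff using X\<^sub>0_L1_le(2)[OF diff_in, of k] by linarith
  qed
  have "AE x in lebesgue. convergent (\<lambda>k. f k x)"
  proof (rule AE_convergent_of_summable_increments)
    show "integrable lebesgue (\<lambda>x. \<bar>f (Suc k) x - f k x\<bar>)" for k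
      unfolding f_diff by (rule X\<^sub>0_L1_le(1)[OF diff_in])
    show "summable (\<lambda>k. LINT x|lebesgue. \<bar>f (Suc k) x - f k x\<bar>)"
    proof (rule summable_comparison_test')
      show "summable (\<lambda>k. sqrt (measure lborel \<Omega>) * (1 / 2) ^ k)"
        by (intro summable_mult summable_geometric) simp
      show "norm (LINT x|lebesgue. \<bar>f (Suc k) x - f k x\<bar>) \<le> sqrt (measure lborel \<Omega>) * (1 / 2) ^ k"
        if "k \<ge> 0" for k
        using increment[of k] by (simp add: integral_nonneg_AE)
    qed
  qed
  moreover have "AE x in lebesgue. \<forall>n. x \<notin> \<Omega> \<longrightarrow> u n x = 0"
    unfolding AE_all_countable using X\<^sub>0_outside[OF u] by blast
  ultimately have lim: "AE x in lebesgue. (\<lambda>k. u (r k) x) \<longlonglongrightarrow> lim (\<lambda>k. f k x)"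
  proof eventually_elim
    case (elim x)
    then have "(\<lambda>k. u (r k) x) = (\<lambda>k. f k x)" by (auto simp: f_def indicator_def)
    then show ?case using elim(1) by (simp add: convergent_LIMSEQ_iff)
  qed
  have f_meas: "f k \<in> borel_measurable lebesgue" for k
    unfolding f_def[abs_def] using X\<^sub>0_measurable[OF u[of "r k"]] \<Omega>_measurable by measurable
  show thesis
  proof (rule that[OF r_mono _ _ lim])
    show "(\<lambda>x. lim (\<lambda>k. f k x)) \<in> borel_measurable lebesgue"
      by (rule borel_measurable_lim_metric[OF f_meas])
    show "\<forall>x. x \<notin> \<Omega> \<longrightarrow> lim (\<lambda>k. f k x) = 0"
      by (simp add: f_def)
  qed
qed

text \<open>Fatou's lemma along the almost everywhere convergent subsequence gives both the convergence in \<open>L\<^sup>2\<close>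
and the lower semicontinuity of the energy.\<close>

lemma form_closed:
  fixes u :: "nat \<Rightarrow> real ^ 'n \<Rightarrow> real"
  assumes u: "\<And>n. u n \<in> X\<^sub>0"
    and cauchy: "\<And>e. e > 0 \<Longrightarrow>
      \<exists>N. \<forall>m\<ge>N. \<forall>n\<ge>N. L2_form (\<lambda>x. u m x - u n x) (\<lambda>x. u m x - u n x) < e"
    and E_lim: "(\<lambda>n. energy_form (u n) (u n)) \<longlonglongrightarrow> c"
  shows "\<exists>v\<in>X\<^sub>0. (\<lambda>n. L2_form (\<lambda>x. u n x - v x) (\<lambda>x. u n x - v x)) \<longlonglongrightarrow> 0 \<and> energy_form v v \<le> c"
proof -
  obtain r v where r: "strict_mono r" and v: "v \<in> borel_measurable lebesgue"
      "\<forall>x. x \<notin> \<Omega> \<longrightarrow> v x = 0"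
    and lim: "AE x in lebesgue. (\<lambda>k. u (r k) x) \<longlonglongrightarrow> v x"
    using u cauchy by (rule L2_Cauchy_AE_limit)
  have lim': "AE x in lborel. (\<lambda>k. u (r k) x) \<longlonglongrightarrow> v x"
    using lim by (simp add: AE_completion_iff)
  have sq: "integrable lebesgue (\<lambda>x. (u n x - v x)\<^sup>2) \<and> (LINT x|lebesgue. (u n x - v x)\<^sup>2) \<le> e"
    if N: "\<forall>m\<ge>N. \<forall>n\<ge>N. L2_form (\<lambda>x. u m x - u n x) (\<lambda>x. u m x - u n x) < e" and n: "n \<ge> N"
    for N n e
  proof -
    have d: "(\<lambda>x. u n x - u (r k) x) \<in> X\<^sub>0" for k using u by (intro E.V_diff)
    have "\<forall>\<^sub>F k in sequentially. (LINT x|lebesgue. (u n x - u (r k) x)\<^sup>2) \<le> e"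
      using eventually_ge_at_top[of N]
    proof eventually_elim
      case (elim k)
      then have "N \<le> r k" using seq_suble[OF r, of k] by simp
      then show ?case unfolding X\<^sub>0_full_L2(2)[OF d] using N n by (intro less_imp_le) blast
    qed
    moreover have "AE x in lebesgue. (\<lambda>k. u n x - u (r k) x) \<longlonglongrightarrow> u n x - v x"
      using lim by eventually_elim (intro tendsto_intros)
    moreover have "(\<lambda>x. u n x - v x) \<in> borel_measurable lebesgue"
      using X\<^sub>0_measurable[OF u] v(1) by measurable
    ultimately show ?thesis
      by (intro conjI fatou_square_integral[OF X\<^sub>0_full_L2(1)[OF d], where g = "\<lambda>x. u n x - v x"])
  qed
  have energy: "integrable lebesgue (\<lambda>p. (weighted_diff v p)\<^sup>2)
      \<and> (LINT p|lebesgue. (weighted_diff v p)\<^sup>2) \<le> c + e" if "e > 0" for e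
  proof -
    have "(\<lambda>k. energy_form (u (r k)) (u (r k))) \<longlonglongrightarrow> c"
      using LIMSEQ_subseq_LIMSEQ[OF E_lim r] by (simp add: o_def)
    then have "\<forall>\<^sub>F k in sequentially. energy_form (u (r k)) (u (r k)) < c + e"
      by (rule order_tendstoD) (use that in simp)
    then have "\<forall>\<^sub>F k in sequentially. (LINT p|lebesgue. (weighted_diff (u (r k)) p)\<^sup>2) \<le> c + e"
      by eventually_elim (simp add: X\<^sub>0_full_energy(2)[OF u])
    moreover have "AE p in lebesgue. (\<lambda>k. weighted_diff (u (r k)) p) \<longlonglongrightarrow> weighted_diff v p"
      using AE_completion[OF AE_lborel_fst[OF lim']] AE_completion[OF AE_lborel_snd[OF lim']]
      by eventually_elim (auto simp: weighted_diff_def case_prod_unfold intro!: tendsto_intros)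
    ultimately show ?thesis
      by (intro conjI fatou_square_integral[OF X\<^sub>0_full_energy(1)[OF u] weighted_diff_measurable[OF v(1)]])
  qed
  have v_in: "v \<in> X\<^sub>0"
  proof (rule X\<^sub>0_I[OF v(1)])
    obtain N where "\<forall>m\<ge>N. \<forall>n\<ge>N. L2_form (\<lambda>x. u m x - u n x) (\<lambda>x. u m x - u n x) < 1"
      using cauchy[OF zero_less_one] by (rule exE)
    from sq[OF this order_refl] have d: "integrable lebesgue (\<lambda>x. (u N x - v x)\<^sup>2)" by (rule conjunct1)
    \<comment> \<open>\<open>v\<close> is at finite \<open>L\<^sup>2\<close> distance from \<open>u N\<close>.\<close>
    have "integrable lebesgue (\<lambda>x. (v x)\<^sup>2)"
    proof (rule Bochner_Integration.integrable_bound)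
      show "integrable lebesgue (\<lambda>x. 2 * (u N x)\<^sup>2 + 2 * (u N x - v x)\<^sup>2)"
        using d X\<^sub>0_full_L2(1)[OF u] by simp
      have "(b :: real)\<^sup>2 \<le> 2 * a\<^sup>2 + 2 * (a - b)\<^sup>2" for a b
        using zero_le_power2[of "2 * a - b"] by (simp add: power2_eq_square algebra_simps)
      then show "AE x in lebesgue. norm ((v x)\<^sup>2) \<le> norm (2 * (u N x)\<^sup>2 + 2 * (u N x - v x)\<^sup>2)"
        by simp
      show "(\<lambda>x. (v x)\<^sup>2) \<in> borel_measurable lebesgue" using v(1) by measurable
    qed
    then show "set_integrable lebesgue \<Omega> (\<lambda>x. (v x)\<^sup>2)"
      unfolding set_integrable_def by (rule integrable_mult_indicator[OF \<Omega>_measurable])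
    show "set_integrable lebesgue Q (\<lambda>p. (weighted_diff v p)\<^sup>2)"
      unfolding set_integrable_def
      by (rule integrable_mult_indicator[OF Q_measurable conjunct1[OF energy[of 1]]]) simp
    show "AE x in lebesgue. x \<notin> \<Omega> \<longrightarrow> v x = 0" using v(2) by simp
  qed
  have "(\<lambda>n. L2_form (\<lambda>x. u n x - v x) (\<lambda>x. u n x - v x)) \<longlonglongrightarrow> 0"
  proof (rule LIMSEQ_I)
    fix e :: real assume e: "e > 0"
    obtain N where N: "\<forall>m\<ge>N. \<forall>n\<ge>N. L2_form (\<lambda>x. u m x - u n x) (\<lambda>x. u m x - u n x) < e / 2"
      using cauchy[OF half_gt_zero[OF e]] by (rule exE)
    have "norm (L2_form (\<lambda>x. u n x - v x) (\<lambda>x. u n x - v x) - 0) < e" if n: "n \<ge> N" for n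
      using conjunct2[OF sq[OF N n]] e L.B_nonneg[OF E.V_diff[OF u[of n] v_in]]
      by (simp add: X\<^sub>0_full_L2(2)[OF E.V_diff[OF u v_in]])
    then show "\<exists>N. \<forall>n\<ge>N. norm (L2_form (\<lambda>x. u n x - v x) (\<lambda>x. u n x - v x) - 0) < e"
      by blast
  qed
  moreover have "energy_form v v \<le> c"
  proof (rule field_le_epsilon)
    fix e :: real assume "e > 0"
    from conjunct2[OF energy[OF this]] show "energy_form v v \<le> c + e"
      by (simp only: X\<^sub>0_full_energy(2)[OF v_in])
  qed
  ultimately show ?thesis using v_in by (intro bexI[of _ v] conjI)
qed

end

section \<open>A direction orthogonal to a given function\<close>

lemma lborel_distr_minus:
  fixes c :: "'a::euclidean_space"
  shows "distr lborel borel (\<lambda>x. c - x) = lborel"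
  by (subst lborel_affine[of "-1" c]) (auto simp: density_1)

text \<open>Integrating the factor \<open>J\<close> first, each section contributes the same total mass, because
Lebesgue measure is invariant under reflections and translations.\<close>

lemma integrable_convolution_kernel:
  fixes a J :: "'a::euclidean_space \<Rightarrow> real"
  assumes a: "integrable lborel a" and J: "integrable lborel J"
  shows "integrable lborel (\<lambda>p. a (fst p) * J (fst p - snd p))"
    and "integrable lborel (\<lambda>p. a (snd p) * J (fst p - snd p))"
proof -
  have [measurable]: "a \<in> borel_measurable borel" "J \<in> borel_measurable borel"
    using borel_measurable_integrable[OF a] borel_measurable_integrable[OF J] by auto
  have reflect: "integrable lborel (\<lambda>y. J (x - y))"
    "(LINT y|lborel. \<bar>J (x - y)\<bar>) = (LINT y|lborel. \<bar>J y\<bar>)" for x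
    using J integrable_distr_eq[of "\<lambda>y. x - y" lborel borel J]
      integral_distr[of "\<lambda>y. x - y" lborel borel "\<lambda>y. \<bar>J y\<bar>"]
    by (simp_all add: lborel_distr_minus)
  have shift: "integrable lborel (\<lambda>y. J (y - x))"
    "(LINT y|lborel. \<bar>J (y - x)\<bar>) = (LINT y|lborel. \<bar>J y\<bar>)" for x
    using J integrable_distr_eq[of "(+) (- x)" lborel borel J]
      integral_distr[of "(+) (- x)" lborel borel "\<lambda>y. \<bar>J y\<bar>"]
    by (simp_all add: lborel_distr_plus)
  have "integrable (lborel \<Otimes>\<^sub>M lborel) (\<lambda>p. a (fst p) * J (fst p - snd p))"
  proof (rule lborel_pair.Fubini_integrable)
    show "integrable lborel (\<lambda>x. LINT y|lborel. norm (a (fst (x, y)) * J (fst (x, y) - snd (x, y))))"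
      using a by (simp add: abs_mult reflect)
    show "AE x in lborel. integrable lborel (\<lambda>y. a (fst (x, y)) * J (fst (x, y) - snd (x, y)))"
      using reflect by simp
  qed measurable
  then show "integrable lborel (\<lambda>p. a (fst p) * J (fst p - snd p))"
    by (simp only: lborel_prod)
  have "integrable (lborel \<Otimes>\<^sub>M lborel) (\<lambda>p. a (fst p) * J (snd p - fst p))"
  proof (rule lborel_pair.Fubini_integrable)
    show "integrable lborel (\<lambda>x. LINT y|lborel. norm (a (fst (x, y)) * J (snd (x, y) - fst (x, y))))"
      using a by (simp add: abs_mult shift)
    show "AE x in lborel. integrable lborel (\<lambda>y. a (fst (x, y)) * J (snd (x, y) - fst (x, y)))"
      using shift by simp
  qed measurable
  from lborel_pair.integrable_product_swap[OF this]
  show "integrable lborel (\<lambda>p. a (snd p) * J (fst p - snd p))"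
    by (simp add: lborel_prod case_prod_unfold)
qed

definition cone_bump :: "'a::real_normed_vector \<Rightarrow> real \<Rightarrow> 'a \<Rightarrow> real" where
  "cone_bump p r x = max 0 (r - norm (x - p))"

lemma cone_bump_continuous: "continuous_on UNIV (cone_bump p r)"
  unfolding cone_bump_def[abs_def] by (intro continuous_intros)

lemma cone_bump_Lipschitz: "\<bar>cone_bump p r x - cone_bump p r y\<bar> \<le> norm (x - y)"
proof -
  have "\<bar>norm (x - p) - norm (y - p)\<bar> \<le> norm (x - y)"
    using norm_triangle_ineq3[of "x - p" "y - p"] by simp
  then show ?thesis by (auto simp: cone_bump_def max_def)
qed

context kernel_problem begin

text \<open>A bounded Lipschitz function \<open>b\<close> satisfies \<open>(b x - b y)\<^sup>2 \<le> C min (norm (x - y)\<^sup>2) 1\<close>, and this weight times \<open>K\<close>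
is integrable. On \<open>Q\<close> one of the two points lies in \<open>\<Omega>\<close>, which has finite measure, so the
double integral converges.\<close>

lemma cone_bump_in_X\<^sub>0:
  assumes sub: "ball p r \<subseteq> \<Omega>" and r: "r > 0"
  shows "cone_bump p r \<in> X\<^sub>0"
proof (rule X\<^sub>0_I)
  show meas: "cone_bump p r \<in> borel_measurable lebesgue"
    using borel_measurable_continuous_onI[OF cone_bump_continuous] by (intro measurable_completion) simp
  have bound: "0 \<le> cone_bump p r x" "cone_bump p r x \<le> r" for x
    using r by (auto simp: cone_bump_def)
  show "set_integrable lebesgue \<Omega> (\<lambda>x. (cone_bump p r x)\<^sup>2)"
    unfolding set_integrable_def
  proof (rule Bochner_Integration.integrable_bound)
    show "integrable lebesgue (\<lambda>x. r\<^sup>2 * indicator \<Omega> x :: real)"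
      using \<Omega>_finite_measure \<Omega>_measurable by (intro integrable_mult_right integrable_real_indicator) auto
    show "(\<lambda>x. indicator \<Omega> x *\<^sub>R (cone_bump p r x)\<^sup>2) \<in> borel_measurable lebesgue"
      using meas \<Omega>_measurable by measurable
    show "AE x in lebesgue. norm (indicator \<Omega> x *\<^sub>R (cone_bump p r x)\<^sup>2) \<le> norm (r\<^sup>2 * indicator \<Omega> x :: real)"
      using bound by (intro AE_I2) (auto simp: indicator_def power_mono)
  qed
  show "AE x in lebesgue. x \<notin> \<Omega> \<longrightarrow> cone_bump p r x = 0"
    using sub by (intro AE_I2) (auto simp: cone_bump_def dist_norm norm_minus_commute subset_eq)
  define J where "J x = min ((norm x)\<^sup>2) 1 * K x" for x
  obtain J\<^sub>0 where J\<^sub>0: "J\<^sub>0 \<in> borel_measurable borel" "AE x in lborel. J x = J\<^sub>0 x"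
    using completion_ex_borel_measurable_real[OF borel_measurable_integrable[OF K_integrable]]
    by (auto simp: J_def)
  have "integrable lebesgue J\<^sub>0"
    using K_integrable J\<^sub>0 AE_completion[OF J\<^sub>0(2)]
    by (subst Bochner_Integration.integrable_cong_AE[where g = J])
      (auto simp: J_def[abs_def] intro: measurable_completion)
  then have J_int: "integrable lborel J\<^sub>0"
    using J\<^sub>0(1) by (simp add: integrable_completion)
  define a :: "real ^ 'n \<Rightarrow> real" where "a = indicator \<Omega>"
  have a: "integrable lborel a"
    unfolding a_def using \<Omega>_finite_measure by (intro integrable_real_indicator) auto
  define G where "G J p = (1 + r\<^sup>2) * (a (fst p) * J (fst p - snd p) + a (snd p) * J (fst p - snd p))"
    for J :: "real ^ 'n \<Rightarrow> real" and p
  have "integrable lborel (G J\<^sub>0)"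
    unfolding G_def[abs_def] using integrable_convolution_kernel[OF a J_int]
    by (intro integrable_mult_right Bochner_Integration.integrable_add)
  then have G_int: "integrable lebesgue (G J\<^sub>0)"
    using integrable_completion[OF borel_measurable_integrable] by blast
  show "set_integrable lebesgue Q (\<lambda>q. (weighted_diff (cone_bump p r) q)\<^sup>2)"
    unfolding set_integrable_def
  proof (rule Bochner_Integration.integrable_bound[OF G_int])
    show "(\<lambda>q. indicator Q q *\<^sub>R (weighted_diff (cone_bump p r) q)\<^sup>2) \<in> borel_measurable lebesgue"
      using weighted_diff_measurable[OF meas] Q_measurable by measurable
    have pointwise: "indicator Q q * (weighted_diff (cone_bump p r) q)\<^sup>2 \<le> G J q" for q
    proof (cases "fst q = snd q \<or> q \<notin> Q")
      case True
      have "J z \<ge> 0" if "z \<noteq> 0" for z using K_pos[OF that] by (simp add: J_def)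
      moreover have "J 0 = 0" by (simp add: J_def)
      ultimately have "J z \<ge> 0" for z by (cases "z = 0") auto
      then have "G J q \<ge> 0" by (auto simp: G_def a_def)
      then show ?thesis using True by (auto simp: weighted_diff_def case_prod_unfold)
    next
      case False
      let ?x = "fst q" and ?y = "snd q"
      let ?b = "cone_bump p r ?x - cone_bump p r ?y"
      have K: "K (?x - ?y) > 0" using False K_pos by simp
      have "\<bar>?b\<bar> \<le> r" using bound[of ?x] bound[of ?y] by linarith
      then have b1: "?b\<^sup>2 \<le> r\<^sup>2" by (simp add: abs_le_square_iff[symmetric] r less_imp_le)
      have b2: "?b\<^sup>2 \<le> (norm (?x - ?y))\<^sup>2"
        using cone_bump_Lipschitz[of p r ?x ?y] by (simp add: abs_le_square_iff[symmetric])
      have "?b\<^sup>2 \<le> (1 + r\<^sup>2) * min ((norm (?x - ?y))\<^sup>2) 1"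
      proof (cases "(norm (?x - ?y))\<^sup>2 \<le> 1")
        case True
        have "(norm (?x - ?y))\<^sup>2 \<le> (1 + r\<^sup>2) * (norm (?x - ?y))\<^sup>2" by (simp add: algebra_simps)
        then show ?thesis using True b2 by (simp add: min_def)
      next
        case False
        then show ?thesis using b1 by (simp add: min_def)
      qed
      then have le: "?b\<^sup>2 * K (?x - ?y) \<le> (1 + r\<^sup>2) * J (?x - ?y)"
        using K mult_right_mono[of "?b\<^sup>2" _ "K (?x - ?y)"] by (fastforce simp: J_def mult.assoc)
      have "(weighted_diff (cone_bump p r) q)\<^sup>2 = ?b\<^sup>2 * K (?x - ?y)"
        unfolding power2_eq_square[of "weighted_diff (cone_bump p r) q"] weighted_diff_mult
        by (simp add: case_prod_unfold power2_eq_square)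
      moreover have "J (?x - ?y) \<le> a ?x * J (?x - ?y) + a ?y * J (?x - ?y)"
        using False K by (cases q) (auto simp: Q_set_def a_def J_def indicator_def)
      then have "(1 + r\<^sup>2) * J (?x - ?y) \<le> G J q"
        unfolding G_def by (rule mult_left_mono) simp
      ultimately show ?thesis using le False by simp
    qed
    have "AE q in lebesgue. G J q = G J\<^sub>0 q"
      using AE_completion[OF AE_lborel_diff[OF J\<^sub>0(2)]] by eventually_elim (simp add: G_def)
    then show "AE q in lebesgue. norm (indicator Q q *\<^sub>R (weighted_diff (cone_bump p r) q)\<^sup>2) \<le> norm (G J\<^sub>0 q)"
    proof eventually_elim
      case (elim q)
      then show ?case using pointwise[of q] by simp
    qed
  qed
qed

lemma L2_pos_of_continuous:
  assumes v: "v \<in> X\<^sub>0" and cont: "continuous_on UNIV v" and q: "v q \<noteq> 0"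
  shows "L2_form v v > 0"
proof (rule ccontr)
  assume "\<not> L2_form v v > 0"
  then have "L2_form v v = 0" using L.B_nonneg[OF v] by simp
  then have "(LINT x|lebesgue. (v x)\<^sup>2) = 0" by (simp only: X\<^sub>0_full_L2(2)[OF v])
  then have "AE x in lebesgue. (v x)\<^sup>2 = 0"
    using integral_nonneg_eq_0_iff_AE[OF X\<^sub>0_full_L2(1)[OF v]] by simp
  then have "AE x in lebesgue. x \<in> {x. v x = 0}" by simp
  moreover have "closed {x. v x = 0}"
    using cont by (intro closed_Collect_eq continuous_on_const)
  ultimately have "q \<in> {x. v x = 0}" by (intro mem_closed_if_AE_lebesgue)
  then show False using q by simp
qed

text \<open>Two concentric cones of different radii are linearly independent, so some combination of them is
orthogonal to \<open>\<phi>\<close> and not zero. Continuity turns being nonzero at a point into a positive norm.\<close>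

lemma orthogonal_direction_exists:
  assumes \<phi>: "\<phi> \<in> X\<^sub>0"
  shows "\<exists>v\<in>X\<^sub>0. L2_form \<phi> v = 0 \<and> L2_form v v > 0"
proof -
  obtain p where "p \<in> \<Omega>" using \<Omega>_nonempty by blast
  then obtain r where r: "r > 0" "ball p r \<subseteq> \<Omega>"
    using \<Omega>_open open_contains_ball by blast
  let ?b = "cone_bump p (r / 2)" and ?B = "cone_bump p r"
  have "ball p (r / 2) \<subseteq> \<Omega>" using r subset_ball[of "r / 2" r p] by auto
  then have b: "?b \<in> X\<^sub>0" using r by (intro cone_bump_in_X\<^sub>0) auto
  have B: "?B \<in> X\<^sub>0" using r by (intro cone_bump_in_X\<^sub>0) auto
  show ?thesis
  proof (cases "L2_form \<phi> ?b = 0")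
    case True
    have "?b p \<noteq> 0" using r by (simp add: cone_bump_def)
    then show ?thesis using True b L2_pos_of_continuous[OF b cone_bump_continuous] by blast
  next
    case False
    obtain e :: "real ^ 'n" where e: "norm e = 1" using vector_choose_size[of 1] by auto
    let ?v = "\<lambda>x. L2_form \<phi> ?b * ?B x + (- L2_form \<phi> ?B) * ?b x"
    have v: "?v \<in> X\<^sub>0" by (rule L.V_lin[OF B b])
    moreover have "L2_form \<phi> ?v = 0"
      unfolding L.B_lin_right[OF B b \<phi>] by simp
    moreover have "L2_form ?v ?v > 0"
    proof (rule L2_pos_of_continuous[OF v])
      show "continuous_on UNIV ?v" by (intro continuous_intros cone_bump_continuous)
      \<comment> \<open>Between the two radii only the larger cone is nonzero.\<close>
      let ?q = "p + (3 * r / 4) *\<^sub>R e"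
      have "?b ?q = 0" "?B ?q = r / 4" using r e by (auto simp: cone_bump_def)
      then show "?v ?q \<noteq> 0" using False r by simp
    qed
    ultimately show ?thesis by blast
  qed
qed

end

section \<open>Simplicity of the first eigenvalue\<close>

lemma AE_lborel_prod_null:
  fixes A :: "'a::euclidean_space set" and B :: "'b::euclidean_space set"
  assumes A: "A \<in> sets borel" and B: "B \<in> sets borel"
    and null: "AE p in lborel. \<not> (fst p \<in> A \<and> snd p \<in> B)"
  shows "(AE x in lborel. x \<notin> A) \<or> (AE y in lborel. y \<notin> B)"
proof -
  have AB: "A \<times> B \<in> sets (lborel \<Otimes>\<^sub>M lborel)" using A B by auto
  have "AE p in lborel \<Otimes>\<^sub>M lborel. p \<notin> A \<times> B"
    using null unfolding lborel_prod by eventually_elim auto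
  then have "emeasure (lborel \<Otimes>\<^sub>M lborel) (A \<times> B) = 0"
    using AB by (subst (asm) AE_iff_measurable[OF AB]) (auto simp: space_pair_measure)
  then have "emeasure lborel A * emeasure lborel B = 0"
    using A B by (simp add: lborel.emeasure_pair_measure_Times)
  then have "A \<in> null_sets lborel \<or> B \<in> null_sets lborel"
    using A B by (auto simp: null_sets_def)
  then show ?thesis by (elim disjE) (auto dest: AE_not_in)
qed

context kernel_problem begin

text \<open>Replacing \<open>u\<close> by \<open>\<bar>u\<bar>\<close> keeps the \<open>L\<^sup>2\<close> norm and does not increase the energy; pointwise the decrease is
strict at pairs where \<open>u\<close> has opposite signs, since \<open>K > 0\<close>. A minimizer admits no decrease, so
the product \<open>{u > 0} \<times> {u < 0}\<close> is null, and one of its factors is.\<close>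

lemma minimizer_constant_sign:
  assumes min: "\<And>w. w \<in> X\<^sub>0 \<Longrightarrow> \<mu> * L2_form w w \<le> energy_form w w"
    and u: "u \<in> X\<^sub>0" and eq: "energy_form u u = \<mu> * L2_form u u"
  shows "(AE x in lborel. u x \<ge> 0) \<or> (AE x in lborel. u x \<le> 0)"
proof -
  define a where "a x = \<bar>u x\<bar>" for x
  have a_meas: "a \<in> borel_measurable lebesgue"
    unfolding a_def[abs_def] using X\<^sub>0_measurable[OF u] by measurable
  have le: "(weighted_diff a p)\<^sup>2 \<le> (weighted_diff u p)\<^sup>2" for p
  proof -
    have "\<bar>a x - a y\<bar> \<le> \<bar>u x - u y\<bar>" for x y unfolding a_def by simp
    then have "\<bar>weighted_diff a p\<bar> \<le> \<bar>weighted_diff u p\<bar>"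
      by (cases p) (auto simp: weighted_diff_def abs_mult intro: mult_right_mono)
    then show ?thesis by (simp add: abs_le_square_iff)
  qed
  have a: "a \<in> X\<^sub>0"
  proof (rule X\<^sub>0_I[OF a_meas])
    show "set_integrable lebesgue \<Omega> (\<lambda>x. (a x)\<^sup>2)"
      using L2_integrable[OF u u] by (simp add: a_def power2_eq_square)
    have "integrable lebesgue (\<lambda>p. (weighted_diff a p)\<^sup>2)"
      by (rule Bochner_Integration.integrable_bound[OF X\<^sub>0_full_energy(1)[OF u]])
        (use le weighted_diff_measurable[OF a_meas] in auto)
    then show "set_integrable lebesgue Q (\<lambda>p. (weighted_diff a p)\<^sup>2)"
      unfolding set_integrable_def by (rule integrable_mult_indicator[OF Q_measurable])
    show "AE x in lebesgue. x \<notin> \<Omega> \<longrightarrow> a x = 0"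
      using X\<^sub>0_outside[OF u] by eventually_elim (simp add: a_def)
  qed
  have "L2_form a a = L2_form u u"
    unfolding L2_form_def by (simp add: a_def)
  then have "energy_form u u \<le> energy_form a a" using min[OF a] eq by simp
  then have zero: "(LINT p|lebesgue. (weighted_diff u p)\<^sup>2 - (weighted_diff a p)\<^sup>2) \<le> 0"
    by (simp add: X\<^sub>0_full_energy u a)
  have "AE p in lebesgue. (weighted_diff u p)\<^sup>2 - (weighted_diff a p)\<^sup>2 = 0"
  proof (subst integral_nonneg_eq_0_iff_AE[symmetric])
    show "integrable lebesgue (\<lambda>p. (weighted_diff u p)\<^sup>2 - (weighted_diff a p)\<^sup>2)"
      using X\<^sub>0_full_energy(1) u a by (intro Bochner_Integration.integrable_diff)
    have "0 \<le> (LINT p|lebesgue. (weighted_diff u p)\<^sup>2 - (weighted_diff a p)\<^sup>2)"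
      using le by (intro integral_nonneg_AE) simp
    then show "(LINT p|lebesgue. (weighted_diff u p)\<^sup>2 - (weighted_diff a p)\<^sup>2) = 0"
      using zero by linarith
  qed (use le in auto)
  then have no_change: "AE p in lebesgue. \<not> (u (fst p) > 0 \<and> u (snd p) < 0)"
  proof eventually_elim
    case (elim p)
    show ?case
    proof
      assume signs: "u (fst p) > 0 \<and> u (snd p) < 0"
      then have "fst p \<noteq> snd p" by auto
      then have "sqrt (K (fst p - snd p)) > 0" using K_pos by simp
      moreover have "\<bar>a (fst p) - a (snd p)\<bar> < \<bar>u (fst p) - u (snd p)\<bar>"
        using signs by (auto simp: a_def)
      ultimately have "\<bar>weighted_diff a p\<bar> < \<bar>weighted_diff u p\<bar>"
        by (simp add: weighted_diff_def case_prod_unfold abs_mult)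
      then have "(weighted_diff a p)\<^sup>2 < (weighted_diff u p)\<^sup>2"
        using power_strict_mono[of "\<bar>weighted_diff a p\<bar>" "\<bar>weighted_diff u p\<bar>" 2] by simp
      then show False using elim by simp
    qed
  qed
  obtain g where g: "g \<in> borel_measurable borel" "AE x in lborel. u x = g x"
    using completion_ex_borel_measurable_real[OF X\<^sub>0_measurable[OF u]] by auto
  have "AE p in lborel. \<not> (fst p \<in> {x. g x > 0} \<and> snd p \<in> {x. g x < 0})"
    using no_change[unfolded AE_completion_iff] AE_lborel_fst[OF g(2)] AE_lborel_snd[OF g(2)]
    by eventually_elim auto
  moreover have "{x. g x > 0} \<in> sets borel" "{x. g x < 0} \<in> sets borel"
    using g(1) by measurable
  ultimately have "(AE x in lborel. x \<notin> {x. g x > 0}) \<or> (AE x in lborel. x \<notin> {x. g x < 0})"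
    by (intro AE_lborel_prod_null)
  then show ?thesis
  proof
    assume "AE x in lborel. x \<notin> {x. g x > 0}"
    with g(2) have "AE x in lborel. u x \<le> 0" by eventually_elim auto
    then show ?thesis ..
  next
    assume "AE x in lborel. x \<notin> {x. g x < 0}"
    with g(2) have "AE x in lborel. u x \<ge> 0" by eventually_elim auto
    then show ?thesis ..
  qed
qed

lemma L2_zero_of_AE:
  assumes "AE x in lborel. u x = 0"
  shows "L2_form u u = 0"
proof -
  have "AE x in lebesgue. indicator \<Omega> x *\<^sub>R (u x * u x) = 0"
    using AE_completion[OF assms] by eventually_elim simp
  then show ?thesis
    unfolding L2_form_def set_lebesgue_integral_def by (rule integral_eq_zero_AE)
qed

text \<open>Two nonnegative orthogonal functions have disjoint supports, so their difference takes both signs.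
But orthogonal minimizers span a space of minimizers, and the difference must have constant sign.\<close>

lemma no_nonnegative_orthogonal_minimizer:
  assumes min: "\<And>w. w \<in> X\<^sub>0 \<Longrightarrow> \<mu> * L2_form w w \<le> energy_form w w"
    and \<phi>: "\<phi> \<in> X\<^sub>0" "energy_form \<phi> \<phi> = \<mu> * L2_form \<phi> \<phi>" "L2_form \<phi> \<phi> > 0" "AE x in lborel. \<phi> x \<ge> 0"
    and \<psi>: "\<psi> \<in> X\<^sub>0" "energy_form \<psi> \<psi> = \<mu> * L2_form \<psi> \<psi>" "L2_form \<psi> \<psi> > 0" "AE x in lborel. \<psi> x \<ge> 0"
    and perp: "L2_form \<phi> \<psi> = 0" "energy_form \<phi> \<psi> = 0"
  shows False
proof -
  let ?w = "\<lambda>x. \<phi> x - \<psi> x"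
  have w: "?w \<in> X\<^sub>0" "energy_form ?w ?w = \<mu> * L2_form ?w ?w"
    using \<phi> \<psi> perp by (simp_all add: E.V_diff E.B_diff_quadratic L.B_diff_quadratic algebra_simps)
  have "AE x in lebesgue. indicator \<Omega> x *\<^sub>R (\<phi> x * \<psi> x) = 0"
  proof (subst integral_nonneg_eq_0_iff_AE[symmetric])
    show "integrable lebesgue (\<lambda>x. indicator \<Omega> x *\<^sub>R (\<phi> x * \<psi> x))"
      using L2_integrable[OF \<phi>(1) \<psi>(1)] by (simp add: set_integrable_def)
    show "AE x in lebesgue. 0 \<le> indicator \<Omega> x *\<^sub>R (\<phi> x * \<psi> x)"
      using AE_completion[OF \<phi>(4)] AE_completion[OF \<psi>(4)] by eventually_elim simp
    show "(LINT x|lebesgue. indicator \<Omega> x *\<^sub>R (\<phi> x * \<psi> x)) = 0"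
      using perp(1) by (simp add: L2_form_def set_lebesgue_integral_def)
  qed
  then have prod: "AE x in lborel. \<phi> x * \<psi> x = 0"
    using X\<^sub>0_outside[OF \<phi>(1)] unfolding AE_completion_iff
    by eventually_elim (auto simp: indicator_def split: if_splits)
  from minimizer_constant_sign[OF min w] show False
  proof
    assume "AE x in lborel. ?w x \<ge> 0"
    with prod \<psi>(4) have "AE x in lborel. \<psi> x = 0" by eventually_elim auto
    from L2_zero_of_AE[OF this] \<psi>(3) show False by simp
  next
    assume "AE x in lborel. ?w x \<le> 0"
    with prod \<phi>(4) have "AE x in lborel. \<phi> x = 0" by eventually_elim auto
    from L2_zero_of_AE[OF this] \<phi>(3) show False by simp
  qed
qed

lemma no_orthogonal_minimizer:
  assumes min: "\<And>w. w \<in> X\<^sub>0 \<Longrightarrow> \<mu> * L2_form w w \<le> energy_form w w"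
    and \<phi>: "\<phi> \<in> X\<^sub>0" "energy_form \<phi> \<phi> = \<mu> * L2_form \<phi> \<phi>" "L2_form \<phi> \<phi> > 0" "AE x in lborel. \<phi> x \<ge> 0"
    and \<psi>: "\<psi> \<in> X\<^sub>0" "energy_form \<psi> \<psi> = \<mu> * L2_form \<psi> \<psi>" "L2_form \<psi> \<psi> > 0"
    and perp: "L2_form \<phi> \<psi> = 0" "energy_form \<phi> \<psi> = 0"
  shows False
  using minimizer_constant_sign[OF min \<psi>(1,2)]
proof
  assume sign: "AE x in lborel. \<psi> x \<ge> 0"
  from no_nonnegative_orthogonal_minimizer[OF min \<phi> \<psi> sign perp] show False .
next
  assume "AE x in lborel. \<psi> x \<le> 0"
  then have sign: "AE x in lborel. (- 1) * \<psi> x \<ge> 0" by eventually_elim simp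
  let ?m = "\<lambda>x. (- 1) * \<psi> x"
  have "L2_form ?m ?m = L2_form \<psi> \<psi>" "energy_form ?m ?m = energy_form \<psi> \<psi>"
    unfolding L.B_scale_quadratic[OF \<psi>(1)] E.B_scale_quadratic[OF \<psi>(1)] by simp_all
  moreover have "L2_form \<phi> ?m = 0" "energy_form \<phi> ?m = 0"
    unfolding L.B_scale_right[OF \<psi>(1) \<phi>(1)] E.B_scale_right[OF \<psi>(1) \<phi>(1)] using perp by simp_all
  ultimately show False
    using no_nonnegative_orthogonal_minimizer[OF min \<phi> E.V_scale[OF \<psi>(1), of "- 1"]] sign \<psi>(2,3)
    by simp
qed

end

section \<open>The second eigenvalue and the minimax value\<close>

context kernel_problem begin

lemma AE_zero_of_L2_zero:
  assumes u: "u \<in> X\<^sub>0" and zero: "L2_form u u = 0"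
  shows "AE x in lebesgue. u x = 0"
proof -
  have "(LINT x|lebesgue. (u x)\<^sup>2) = 0" using zero by (simp only: X\<^sub>0_full_L2(2)[OF u])
  then have "AE x in lebesgue. (u x)\<^sup>2 = 0"
    using integral_nonneg_eq_0_iff_AE[OF X\<^sub>0_full_L2(1)[OF u]] by simp
  then show ?thesis by simp
qed

lemma L2_form_AE_cong:
  assumes u: "u \<in> X\<^sub>0" and v: "v \<in> X\<^sub>0" and w: "w \<in> X\<^sub>0" and eq: "AE x in lebesgue. v x = w x"
  shows "L2_form u v = L2_form u w"
  unfolding L2_form_def set_lebesgue_integral_def
proof (rule integral_cong_AE)
  note [measurable] = X\<^sub>0_measurable[OF u] X\<^sub>0_measurable[OF v] X\<^sub>0_measurable[OF w] \<Omega>_measurable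
  show "(\<lambda>x. indicator \<Omega> x *\<^sub>R (u x * v x)) \<in> borel_measurable lebesgue"
    "(\<lambda>x. indicator \<Omega> x *\<^sub>R (u x * w x)) \<in> borel_measurable lebesgue"
    by measurable
  show "AE x in lebesgue. indicator \<Omega> x *\<^sub>R (u x * v x) = indicator \<Omega> x *\<^sub>R (u x * w x)"
    using eq by eventually_elim simp
qed

lemma P_sphere_iff: "u \<in> P_sphere K \<Omega> \<longleftrightarrow> u \<in> X\<^sub>0 \<and> L2_form u u = 1"
  by (simp add: P_sphere_def L2_form_def power2_eq_square)

lemma X0_norm_eq: "X0_norm K \<Omega> u = sqrt (energy_form u u)"
  by (simp add: X0_norm_def energy_eq)

lemma first_eigenvalue_le:
  assumes w: "w \<in> X\<^sub>0"
  shows "first_eigenvalue K \<Omega> * L2_form w w \<le> energy_form w w"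
proof (cases "L2_form w w = 0")
  case True
  then show ?thesis using E.B_nonneg[OF w] by simp
next
  case False
  then have pos: "L2_form w w > 0" using L.B_nonneg[OF w] by simp
  define c where "c = 1 / sqrt (L2_form w w)"
  let ?v = "\<lambda>x. c * w x"
  have c: "c\<^sup>2 * L2_form w w = 1" using pos by (simp add: c_def power_divide)
  have v: "?v \<in> P_sphere K \<Omega>"
    unfolding P_sphere_iff L.B_scale_quadratic[OF w] using c L.V_scale[OF w] by simp
  have "first_eigenvalue K \<Omega> \<le> (X0_norm K \<Omega> ?v)\<^sup>2"
    unfolding first_eigenvalue_def by (rule cINF_lower[OF bdd_belowI2[of _ 0] v]) simp
  also have "\<dots> = c\<^sup>2 * energy_form w w"
    unfolding X0_norm_eq E.B_scale_quadratic[OF w] using E.B_nonneg[OF w] by simp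
  finally have "first_eigenvalue K \<Omega> * L2_form w w \<le> c\<^sup>2 * energy_form w w * L2_form w w"
    using pos by (intro mult_right_mono) auto
  also have "\<dots> = energy_form w w" using c by (simp add: mult_ac)
  finally show ?thesis .
qed

lemma weak_solution_iff:
  "weak_solution K \<Omega> \<mu> u \<longleftrightarrow> u \<in> X\<^sub>0 \<and> (\<forall>v\<in>X\<^sub>0. energy_form u v = \<mu> * L2_form u v)"
  by (simp add: weak_solution_def energy_form_def L2_form_def)

end

text \<open>From here on the normalized first eigenfunction is given, and the abstract results for a pair of
forms apply to the energy and the \<open>L\<^sup>2\<close> product.\<close>

locale first_eigenfunction_problem = kernel_problem s \<Omega> K
  for s and \<Omega> :: "(real ^ 'n) set" and K +
  fixes \<phi> :: "real ^ 'n \<Rightarrow> real"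
  assumes normalized: "normalized_first_eigenfunction K \<Omega> \<phi>"
begin

abbreviation \<mu>\<^sub>1 where "\<mu>\<^sub>1 \<equiv> first_eigenvalue K \<Omega>"

lemma \<phi>_in: "\<phi> \<in> X\<^sub>0"
  and \<phi>_norm: "L2_form \<phi> \<phi> = 1"
  and \<phi>_weak: "v \<in> X\<^sub>0 \<Longrightarrow> energy_form \<phi> v = \<mu>\<^sub>1 * L2_form \<phi> v"
  and \<phi>_nonneg: "AE x in lborel. \<phi> x \<ge> 0"
  using normalized
  by (auto simp: normalized_first_eigenfunction_def eigenfunction_def weak_solution_iff
      L2_form_def power2_eq_square AE_completion_iff)

lemma \<mu>\<^sub>1_pos: "\<mu>\<^sub>1 > 0"
proof -
  obtain C where C: "C > 0" "\<forall>u\<in>X\<^sub>0. C * L2_form u u \<le> energy_form u u"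
    using poincare by blast
  have "C * L2_form \<phi> \<phi> \<le> energy_form \<phi> \<phi>" using C(2) \<phi>_in by blast
  then show ?thesis using C(1) \<phi>_weak[OF \<phi>_in] \<phi>_norm by simp
qed

sublocale F: form_pair X\<^sub>0 energy_form L2_form \<phi> \<mu>\<^sub>1
  by unfold_locales (fact \<phi>_in \<phi>_norm \<phi>_weak \<mu>\<^sub>1_pos spectral_gap form_closed
      orthogonal_direction_exists[OF \<phi>_in])+

text \<open>Simplicity of the first eigenvalue: equality would make the minimizer \<open>\<psi>\<close> a first eigenfunction
orthogonal to \<open>\<phi>\<close>.\<close>

lemma \<mu>\<^sub>1_less_\<mu>\<^sub>2: "\<mu>\<^sub>1 < F.\<mu>\<^sub>2"
proof -
  obtain \<psi> where \<psi>: "\<psi> \<in> F.perp_sphere" "energy_form \<psi> \<psi> = F.\<mu>\<^sub>2"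
    using F.minimizer_exists by blast
  then have \<psi>': "\<psi> \<in> X\<^sub>0" "L2_form \<phi> \<psi> = 0" "L2_form \<psi> \<psi> = 1"
    by (auto simp: F.perp_sphere_def)
  have "\<mu>\<^sub>1 \<le> F.\<mu>\<^sub>2" using first_eigenvalue_le[OF \<psi>'(1)] \<psi>(2) \<psi>'(3) by simp
  moreover have "\<mu>\<^sub>1 \<noteq> F.\<mu>\<^sub>2"
  proof
    assume eq: "\<mu>\<^sub>1 = F.\<mu>\<^sub>2"
    have E: "energy_form \<phi> \<phi> = \<mu>\<^sub>1 * L2_form \<phi> \<phi>" "energy_form \<psi> \<psi> = \<mu>\<^sub>1 * L2_form \<psi> \<psi>"
        "energy_form \<phi> \<psi> = 0"
      using \<phi>_weak[OF \<phi>_in] \<phi>_weak[OF \<psi>'(1)] \<psi>(2) \<psi>' eq by simp_all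
    have pos: "L2_form \<phi> \<phi> > 0" "L2_form \<psi> \<psi> > 0" using \<phi>_norm \<psi>'(3) by simp_all
    from no_orthogonal_minimizer[OF first_eigenvalue_le \<phi>_in E(1) pos(1) \<phi>_nonneg \<psi>'(1) E(2) pos(2)
        \<psi>'(2) E(3)]
    show False .
  qed
  ultimately show ?thesis by simp
qed

lemma second_eigenvalue_eq: "second_eigenvalue K \<Omega> = F.\<mu>\<^sub>2"
  unfolding second_eigenvalue_def
proof (rule Least_equality)
  obtain \<psi> where \<psi>: "\<psi> \<in> F.perp_sphere" "energy_form \<psi> \<psi> = F.\<mu>\<^sub>2"
    using F.minimizer_exists by blast
  then have \<psi>': "\<psi> \<in> X\<^sub>0" "L2_form \<psi> \<psi> = 1" by (auto simp: F.perp_sphere_def)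
  have "\<not> (AE x in lebesgue. \<psi> x = 0)"
    using L2_zero_of_AE[of \<psi>] \<psi>'(2) by (auto simp: AE_completion_iff)
  then have "eigenfunction K \<Omega> F.\<mu>\<^sub>2 \<psi>"
    using \<psi>' F.minimizer_weak[OF \<psi>] by (simp add: eigenfunction_def weak_solution_iff)
  then show "eigenvalue K \<Omega> F.\<mu>\<^sub>2 \<and> \<mu>\<^sub>1 < F.\<mu>\<^sub>2"
    using \<mu>\<^sub>1_less_\<mu>\<^sub>2 by (auto simp: eigenvalue_def)
next
  fix \<mu> assume "eigenvalue K \<Omega> \<mu> \<and> \<mu>\<^sub>1 < \<mu>"
  then obtain u where u: "u \<in> X\<^sub>0" "\<forall>v\<in>X\<^sub>0. energy_form u v = \<mu> * L2_form u v"
      "\<not> (AE x in lebesgue. u x = 0)" and "\<mu> \<noteq> \<mu>\<^sub>1"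
    by (auto simp: eigenvalue_def eigenfunction_def weak_solution_iff)
  have "L2_form u u > 0"
    using AE_zero_of_L2_zero[OF u(1)] u(3) L.B_nonneg[OF u(1)] by force
  then show "F.\<mu>\<^sub>2 \<le> \<mu>"
    using F.eigenvalue_ge_\<mu>\<^sub>2[OF u(1) _ bspec[OF u(2)] \<open>\<mu> \<noteq> \<mu>\<^sub>1\<close>] by simp
qed

lemma path_facts:
  assumes "\<gamma> \<in> Gamma_paths K \<Omega> \<phi>"
  shows path_in: "\<And>t. t \<in> {-1..1} \<Longrightarrow> \<gamma> t \<in> X\<^sub>0"
    and path_norm: "\<And>t. t \<in> {-1..1} \<Longrightarrow> L2_form (\<gamma> t) (\<gamma> t) = 1"
    and path_tendsto: "\<And>t. t \<in> {-1..1} \<Longrightarrow>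
      ((\<lambda>t'. sqrt (energy_form (\<lambda>x. \<gamma> t' x - \<gamma> t x) (\<lambda>x. \<gamma> t' x - \<gamma> t x))) \<longlongrightarrow> 0)
        (at t within {-1..1})"
    and path_ends: "AE x in lebesgue. \<gamma> (-1) x = - 1 * \<phi> x" "AE x in lebesgue. \<gamma> 1 x = \<phi> x"
  using assms by (auto simp: Gamma_paths_def P_sphere_iff X0_norm_eq)

lemma maximum_on_path:
  assumes \<gamma>: "\<gamma> \<in> Gamma_paths K \<Omega> \<phi>"
  obtains t where "t \<in> {-1..1}"
    "maximum_on (\<gamma> ` {-1..1}) (\<lambda>u. energy_form u u) = energy_form (\<gamma> t) (\<gamma> t)"
    "\<forall>t'\<in>{-1..1}. energy_form (\<gamma> t') (\<gamma> t') \<le> energy_form (\<gamma> t) (\<gamma> t)"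
proof -
  have "continuous_on {-1..1} (\<lambda>t. energy_form (\<gamma> t) (\<gamma> t))"
    by (rule F.continuous_energy_path[OF path_in[OF \<gamma>] path_tendsto[OF \<gamma>]])
  then obtain t where t: "t \<in> {-1..1}"
      "\<forall>t'\<in>{-1..1}. energy_form (\<gamma> t') (\<gamma> t') \<le> energy_form (\<gamma> t) (\<gamma> t)"
    using continuous_attains_sup[of "{-1..1::real}" "\<lambda>t. energy_form (\<gamma> t) (\<gamma> t)"] by auto
  have "maximum_on (\<gamma> ` {-1..1}) (\<lambda>u. energy_form u u) = energy_form (\<gamma> t) (\<gamma> t)"
    unfolding maximum_on_def using t by (intro Greatest_equality) auto
  with t show thesis by (intro that)
qed

text \<open>Every admissible path meets the orthogonal complement of \<open>\<phi>\<close>, where the energy is at least \<open>\<mu>\<^sub>2\<close>.\<close>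

lemma \<mu>\<^sub>2_le_maximum:
  assumes \<gamma>: "\<gamma> \<in> Gamma_paths K \<Omega> \<phi>"
  shows "F.\<mu>\<^sub>2 \<le> maximum_on (\<gamma> ` {-1..1}) (\<lambda>u. energy_form u u)"
proof -
  have "L2_form \<phi> (\<gamma> (-1)) = L2_form \<phi> (\<lambda>x. - 1 * \<phi> x)"
    using path_in[OF \<gamma>, of "-1"] L.V_scale[OF \<phi>_in, of "-1"] path_ends(1)[OF \<gamma>]
    by (intro L2_form_AE_cong \<phi>_in) auto
  then have start: "L2_form \<phi> (\<gamma> (-1)) = -1"
    unfolding L.B_scale_right[OF \<phi>_in \<phi>_in] by (simp add: \<phi>_norm)
  have "L2_form \<phi> (\<gamma> 1) = L2_form \<phi> \<phi>"
    using path_in[OF \<gamma>, of 1] path_ends(2)[OF \<gamma>] by (intro L2_form_AE_cong \<phi>_in) auto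
  then have finish: "L2_form \<phi> (\<gamma> 1) = 1" by (simp add: \<phi>_norm)
  have "\<exists>t\<in>{-1..1}. L2_form \<phi> (\<gamma> t) = 0"
    using start finish
    by (intro F.path_crosses_perp[OF path_in[OF \<gamma>] path_tendsto[OF \<gamma>]]) auto
  then obtain t where t: "t \<in> {-1..1}" "L2_form \<phi> (\<gamma> t) = 0" by blast
  have "F.\<mu>\<^sub>2 \<le> energy_form (\<gamma> t) (\<gamma> t)"
    using t path_in[OF \<gamma> t(1)] path_norm[OF \<gamma> t(1)]
    by (intro F.\<mu>\<^sub>2_le_sphere) (simp add: F.perp_sphere_def)
  moreover obtain t\<^sub>0 where
    "maximum_on (\<gamma> ` {-1..1}) (\<lambda>u. energy_form u u) = energy_form (\<gamma> t\<^sub>0) (\<gamma> t\<^sub>0)"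
    "\<forall>t'\<in>{-1..1}. energy_form (\<gamma> t') (\<gamma> t') \<le> energy_form (\<gamma> t\<^sub>0) (\<gamma> t\<^sub>0)"
    by (rule maximum_on_path[OF \<gamma>])
  ultimately show ?thesis using t(1) by fastforce
qed

text \<open>The half circle through \<open>- \<phi>\<close>, \<open>\<psi>\<close> and \<open>\<phi>\<close>. As \<open>\<phi>\<close> and \<open>\<psi>\<close> are orthogonal for both forms, the
energy along it is a convex combination of \<open>\<mu>\<^sub>1\<close> and \<open>\<mu>\<^sub>2\<close>.\<close>

lemma optimal_path:
  "\<exists>\<gamma>\<in>Gamma_paths K \<Omega> \<phi>. maximum_on (\<gamma> ` {-1..1}) (\<lambda>u. energy_form u u) \<le> F.\<mu>\<^sub>2"
proof -
  obtain \<psi> where \<psi>: "\<psi> \<in> F.perp_sphere" "energy_form \<psi> \<psi> = F.\<mu>\<^sub>2"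
    using F.minimizer_exists by blast
  then have \<psi>': "\<psi> \<in> X\<^sub>0" "L2_form \<phi> \<psi> = 0" "L2_form \<psi> \<psi> = 1"
    by (auto simp: F.perp_sphere_def)
  have E: "energy_form \<phi> \<phi> = \<mu>\<^sub>1" "energy_form \<phi> \<psi> = 0"
    using \<phi>_weak[OF \<phi>_in] \<phi>_weak[OF \<psi>'(1)] \<phi>_norm \<psi>'(2) by simp_all
  have quad: "energy_form (\<lambda>x. a * \<phi> x + b * \<psi> x) (\<lambda>x. a * \<phi> x + b * \<psi> x) = a\<^sup>2 * \<mu>\<^sub>1 + b\<^sup>2 * F.\<mu>\<^sub>2"
    for a b
    using E.B_quadratic[OF \<phi>_in \<psi>'(1)] E \<psi>(2) by simp
  define S C where "S t = sin (pi / 2 * t)" and "C t = cos (pi / 2 * t)" for t :: real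
  define \<gamma> where "\<gamma> t x = S t * \<phi> x + C t * \<psi> x" for t x
  have diff: "(\<lambda>x. \<gamma> t' x - \<gamma> t x) = (\<lambda>x. (S t' - S t) * \<phi> x + (C t' - C t) * \<psi> x)" for t t'
    by (simp add: \<gamma>_def algebra_simps)
  have in_P: "\<gamma> t \<in> P_sphere K \<Omega>" for t
    unfolding P_sphere_iff \<gamma>_def[abs_def] L.B_quadratic[OF \<phi>_in \<psi>'(1)]
    using E.V_lin[OF \<phi>_in \<psi>'(1)] by (simp add: \<phi>_norm \<psi>' S_def C_def)
  have cont: "((\<lambda>t'. X0_norm K \<Omega> (\<lambda>x. \<gamma> t' x - \<gamma> t x)) \<longlongrightarrow> 0) (at t within {-1..1})" for t
  proof -
    have "((\<lambda>t'. sqrt ((S t' - S t)\<^sup>2 * \<mu>\<^sub>1 + (C t' - C t)\<^sup>2 * F.\<mu>\<^sub>2)) \<longlongrightarrow>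
        sqrt ((S t - S t)\<^sup>2 * \<mu>\<^sub>1 + (C t - C t)\<^sup>2 * F.\<mu>\<^sub>2)) (at t within {-1..1})"
      unfolding S_def C_def by (intro tendsto_intros)
    then show ?thesis unfolding X0_norm_eq diff quad by simp
  qed
  have ends: "\<gamma> (-1) x = - \<phi> x" "\<gamma> 1 x = \<phi> x" for x
    by (simp_all add: \<gamma>_def S_def C_def)
  have \<gamma>: "\<gamma> \<in> Gamma_paths K \<Omega> \<phi>"
    using in_P cont ends by (simp add: Gamma_paths_def)
  have "energy_form (\<gamma> t) (\<gamma> t) \<le> F.\<mu>\<^sub>2" for t
  proof -
    have "energy_form (\<gamma> t) (\<gamma> t) = (S t)\<^sup>2 * \<mu>\<^sub>1 + (C t)\<^sup>2 * F.\<mu>\<^sub>2"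
      unfolding \<gamma>_def[abs_def] by (rule quad)
    also have "\<dots> \<le> (S t)\<^sup>2 * F.\<mu>\<^sub>2 + (C t)\<^sup>2 * F.\<mu>\<^sub>2"
      using \<mu>\<^sub>1_less_\<mu>\<^sub>2 by (intro add_right_mono mult_left_mono) auto
    also have "\<dots> = F.\<mu>\<^sub>2"
      unfolding distrib_right[symmetric] by (simp add: S_def C_def)
    finally show ?thesis .
  qed
  with maximum_on_path[OF \<gamma>] have "maximum_on (\<gamma> ` {-1..1}) (\<lambda>u. energy_form u u) \<le> F.\<mu>\<^sub>2" by metis
  with \<gamma> show ?thesis by blast
qed

lemma minimax: "F.\<mu>\<^sub>2 =
  (INF \<gamma>\<in>Gamma_paths K \<Omega> \<phi>. maximum_on (\<gamma> ` {-1..1}) (\<lambda>u. energy_form u u))"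
proof -
  obtain \<gamma> where \<gamma>: "\<gamma> \<in> Gamma_paths K \<Omega> \<phi>"
      "maximum_on (\<gamma> ` {-1..1}) (\<lambda>u. energy_form u u) \<le> F.\<mu>\<^sub>2"
    using optimal_path by blast
  then have "maximum_on (\<gamma> ` {-1..1}) (\<lambda>u. energy_form u u) = F.\<mu>\<^sub>2"
    using \<mu>\<^sub>2_le_maximum by (intro antisym)
  with \<gamma>(1) have "F.\<mu>\<^sub>2 \<in>
      (\<lambda>\<gamma>. maximum_on (\<gamma> ` {-1..1}) (\<lambda>u. energy_form u u)) ` Gamma_paths K \<Omega> \<phi>"
    by (intro image_eqI[of _ _ \<gamma>]) simp_all
  then show ?thesis
    by (intro cInf_eq_minimum[symmetric]) (auto intro: \<mu>\<^sub>2_le_maximum)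
qed

end

theorem corollary3p5:
  fixes s :: real and \<Omega> :: "(real ^ 'n) set" and K \<phi>1 :: "real ^ 'n \<Rightarrow> real"
  assumes "0 < s" and "s < 1" and "real CARD('n) > 2 * s"
    and "bounded_lipschitz_domain \<Omega>"
    and "admissible_kernel s K"
    and "normalized_first_eigenfunction K \<Omega> \<phi>1"
  shows "second_eigenvalue K \<Omega> =
    (INF \<gamma> \<in> Gamma_paths K \<Omega> \<phi>1. maximum_on (\<gamma> ` {-1..1})
       (\<lambda>u. LINT (x, y):Q_set \<Omega>|lebesgue. (u x - u y)\<^sup>2 * K (x - y)))"
proof -
  interpret first_eigenfunction_problem s \<Omega> K \<phi>1
    using assms by unfold_locales (auto simp only: bounded_lipschitz_domain_def)
  have "(\<lambda>u. LINT (x, y):Q_set \<Omega>|lebesgue. (u x - u y)\<^sup>2 * K (x - y)) = (\<lambda>u. energy_form u u)"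
    unfolding energy_eq[symmetric] energy_def ..
  then show ?thesis
    by (simp only: second_eigenvalue_eq minimax)
qed

end
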